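(* Let $p=2$ and let $n\ge k\ge 1$ be integers with $\nu_2(k)\le\nu_2(n)$. Let $M$ be the maximum pole of $B_{n-k}^{(-k)}(x)$. Then the following are equivalent: (1) $S(n,k)$ is an almost minimum zero case (AMZC); (2) $S(n+1,k+1)$ is a shifted almost minimum zero case (SAMZC); (3) either $\nu_2\left(\binom{n+n-k}{n}\right)=\sigma_2(n-k)-M$, or [$n-k$ is odd and $\nu_2\left(\binom{n+n-k-2}{n}\right)=\sigma_2(n-k)-(M+1)$], where the "or" is exclusive; (4) with $u$ the partition with $u_1=n-k$ (all other parts zero) and, when $n-k\ge 3$ is odd, $u'$ the partition with $u'_1=n-k-3$, $u'_3=1$ (all other parts zero), either $\nu_2(\tau_u)=-M$, or [$n-k\geq 3$ is odd and] $\nu_2(\tau_{u'})=-M$, again with exclusive "or". Furthermore, if these conditions hold, then $\nu_2(S(n,k))=\nu_2(S(n+1,k+1))$. In this case, if $\nu_2(\tau_u)=-M$, then $\nu_2(S(n,k))=\sigma_2(k)-\sigma_2(n)+\nu_2\left(\binom{n+n-k}{n}\right)$, and if ($n-k\ge 3$ is odd and) $\nu_2(\tau_{u'})=-M$, then $\nu_2(S(n,k))=\sigma_2(k)-\sigma_2(n)+\nu_2\left(\binom{n+n-k-2}{n}\right)+1$.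
   Context: $S(n,k)$ is the Stirling number of the second kind; $\sigma_2(m)$ is the sum of the base $2$ digits of $m\ge 0$; $\nu_2$ is the $2$-adic valuation, with $\nu_2(0)=\infty$. For $s\in\mathbb Z$ and $d\ge 0$, $\binom sd=s(s-1)\cdots(s-d+1)/d!$. Higher order Bernoulli polynomials $B_m^{(l)}(x)$ ($m\ge 0$, $l\in\mathbb Z$) are defined by $\left(\frac{t}{e^t-1}\right)^l e^{tx}=\sum_{m\ge 0}B_m^{(l)}(x)\frac{t^m}{m!}$; $B_m^{(l)}(x)$ is monic of degree $m$ with rational coefficients, and $B_m^{(l)}=B_m^{(l)}(0)$. The maximum pole (here with respect to $p=2$) of a nonzero rational polynomial is the integer $M$ such that $-M$ is the minimum of the $2$-adic valuations of its coefficients. One has $S(n,k)=\binom nk B_{n-k}^{(-k)}=\binom{n-1}{k-1}B_{n-k}^{(-k+1)}(1)$. $S(n,k)$ is an almost minimum zero case (AMZC) if $\nu_2(S(n,k))=\nu_2\left(\binom nk\right)-M$, where $M$ is the maximum pole of $B_{n-k}^{(-k)}(x)$. $S(n,k)$ is a shifted almost minimum zero case (SAMZC) if $\nu_2(S(n,k))=\nu_2\left(\binom{n-1}{k-1}\right)-M'$, where $M'$ is the maximum pole of $B_{n-k}^{(-k+1)}(x)$. For a partition $v=(v_1,v_2,\dots)$ (nonnegative integers, eventually zero) with weight $w=\sum iv_i\le n-k$ and $d=\sum v_i$, set $t_v=\binom{-n-1}{d}\binom{d}{v_1\,v_2\,\cdots}\big/\prod_i(i+1)^{v_i}$ and $\tau_v=\frac{(n-k)!}{(n-k-w)!}t_v$.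 *)

theory Defs
  imports
    "HOL-Library.Extended_Real"
    "HOL-Combinatorics.Stirling"
    "HOL-Computational_Algebra.Computational_Algebra"
begin

definition val2 :: "rat \<Rightarrow> int" where
  "val2 x = int (multiplicity 2 (fst (quotient_of x))) - int (multiplicity 2 (snd (quotient_of x)))"

text \<open>\<^const>\<open>val2\<close> is meaningful for nonzero arguments only; \<open>nu2\<close> adds the convention
  that the valuation of 0 is infinite.\<close>

definition nu2 :: "rat \<Rightarrow> ereal" where
  "nu2 x = (if x = 0 then \<infinity> else ereal (of_int (val2 x)))"

fun sigma2 :: "nat \<Rightarrow> nat" where
  "sigma2 m = (if m = 0 then 0 else m mod 2 + sigma2 (m div 2))"

declare sigma2.simps [simp del]

text \<open>The defining generating function is read in the ring of formal power series in \<open>t\<close> over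
  the polynomials in \<open>x\<close>. The division of power series is exact, because both series
  have subdegree 1; the quotient has constant term 1, so that its integer powers
  (also the negative ones) are the true ones.\<close>

definition bern_gen :: "rat fps" where
  "bern_gen = fps_X / (fps_exp 1 - 1)"

definition ho_bernpoly :: "nat \<Rightarrow> int \<Rightarrow> rat poly" where
  "ho_bernpoly m l =
     smult (fact m)
       (fps_nth (Abs_fps (\<lambda>j. [:fps_nth (bern_gen powi l) j:]) *
                 Abs_fps (\<lambda>j. monom (1 / fact j) j)) m)"

lemma ho_bernpoly_generating_function:
  "Abs_fps (\<lambda>m. poly (ho_bernpoly m l) x / fact m) = bern_gen powi l * fps_exp x"
  by (rule fps_ext)
     (simp add: ho_bernpoly_def fps_mult_nth poly_sum poly_monom)

text \<open>For a nonzero polynomial. Zero coefficients have infinite valuation and hence do not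
  contribute to the minimum.\<close>

definition max_pole :: "rat poly \<Rightarrow> int" where
  "max_pole f = - Min (val2 ` (set (coeffs f) - {0}))"

text \<open>Both predicates are intended for \<open>1 \<le> k \<le> n\<close>.\<close>

definition AMZC :: "nat \<Rightarrow> nat \<Rightarrow> bool" where
  "AMZC n k \<longleftrightarrow>
     nu2 (of_nat (Stirling n k)) =
     nu2 (of_nat (n choose k)) - ereal (of_int (max_pole (ho_bernpoly (n - k) (- int k))))"

definition SAMZC :: "nat \<Rightarrow> nat \<Rightarrow> bool" where
  "SAMZC n k \<longleftrightarrow>
     nu2 (of_nat (Stirling n k)) =
     nu2 (of_nat ((n - 1) choose (k - 1))) -
       ereal (of_int (max_pole (ho_bernpoly (n - k) (- int k + 1))))"

text \<open>A partition is a function \<open>v\<close> with \<open>v i\<close> the number of parts equal to \<open>i\<close>, for \<open>i \<ge> 1\<close>, and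
  with finite support; the value \<open>v 0\<close> is ignored.\<close>

definition part_supp :: "(nat \<Rightarrow> nat) \<Rightarrow> nat set" where
  "part_supp v = {i. i \<ge> 1 \<and> v i \<noteq> 0}"

definition part_weight :: "(nat \<Rightarrow> nat) \<Rightarrow> nat" where
  "part_weight v = (\<Sum>i\<in>part_supp v. i * v i)"

definition part_size :: "(nat \<Rightarrow> nat) \<Rightarrow> nat" where
  "part_size v = (\<Sum>i\<in>part_supp v. v i)"

definition part_t :: "nat \<Rightarrow> (nat \<Rightarrow> nat) \<Rightarrow> rat" where
  "part_t n v =
     ((- of_nat n - 1) gchoose part_size v) *
     (fact (part_size v) / (\<Prod>i\<in>part_supp v. fact (v i))) /
     (\<Prod>i\<in>part_supp v. of_nat (i + 1) ^ v i)"

text \<open>Intended for \<open>k \<le> n\<close> and \<open>part_weight v \<le> n - k\<close>.\<close>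

definition part_tau :: "nat \<Rightarrow> nat \<Rightarrow> (nat \<Rightarrow> nat) \<Rightarrow> rat" where
  "part_tau n k v = fact (n - k) / fact (n - k - part_weight v) * part_t n v"

end

theory Submission
  imports Defs
begin

text \<open>
  Put \<open>m = n - k\<close>, \<open>F = (e\<^sup>t - 1) / t\<close> and let \<open>\<sigma>\<close> be the binary digit sum. Expanding
  \<open>e\<^sup>x\<^sup>t F\<^sup>k = e\<^sup>t F\<^sup>k (1 + t F)\<^sup>x\<^sup>-\<^sup>1\<close> in powers of \<open>t F\<close> writes \<open>B\<^sub>m\<^sup>(\<^sup>-\<^sup>k\<^sup>)(x)\<close> in the monic
  integral basis \<open>(x - 1)\<cdots>(x - j)\<close>, so the maximum pole can be read off the coefficients
  \<open>a\<^sub>j = m!/j! [t\<^sup>w] e\<^sup>t F\<^sup>n\<^sup>-\<^sup>w\<close>, \<open>w = m - j\<close>. A recurrence in \<open>n\<close> (a form of Lagrange inversion)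
  identifies \<open>2\<^sup>w [t\<^sup>w] e\<^sup>t F\<^sup>n\<^sup>-\<^sup>w\<close> with the coefficient of \<open>s\<^sup>w\<close> in \<open>L\<^sup>-\<^sup>n\<^sup>-\<^sup>1\<close>, where
  \<open>L = log (1 + 2 s) / (2 s) = 1 - s P\<close>, that is, with
  \<open>c\<^sub>w = (\<Sum>j\<le>w. b\<^sub>j [s\<^sup>w\<^sup>-\<^sup>j] P\<^sup>j)\<close>, \<open>b\<^sub>j = (n + j choose j)\<close>.

  The coefficient of \<open>s\<^sup>i\<close> in \<open>P\<^sup>j\<close> has valuation at least \<open>\<sigma> i\<close>, and more than that unless
  \<open>i = 0\<close> (value 1) or \<open>i = 2\<close> (value \<open>2 j\<close> modulo 4). As \<open>\<sigma>\<close> is subadditive, the minimum over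
  \<open>w \<le> m\<close> of \<open>\<nu> c\<^sub>w + \<sigma> (m - w)\<close>, which equals \<open>\<sigma> m - M\<close>, is the same for \<open>b\<close> as for \<open>c\<close>, and
  \<open>c\<^sub>m\<close> is congruent to \<open>b\<^sub>m + 2 (m - 2) b\<^sub>m\<^sub>-\<^sub>2\<close> modulo a higher power of 2. Hence \<open>B(1) = a\<^sub>0\<close> attains
  the maximum pole iff exactly one of these two summands has valuation \<open>\<sigma> m - M\<close>; they are the
  contributions of the partitions \<open>u\<close> and \<open>u'\<close>. Finally \<open>B(0) - a\<^sub>0 + a\<^sub>1\<close> is an even combination of
  the \<open>a\<^sub>j\<close>, and \<open>\<nu> k \<le> \<nu> n\<close> forces \<open>\<nu> a\<^sub>1 > -M\<close>, so \<open>B(0)\<close> and \<open>B(1)\<close> behave alike.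
\<close>

unbundle fps_syntax

section \<open>Two-adic valuations and binary digit sums\<close>

text \<open>Zero satisfies every bound, matching its infinite valuation; so the predicate is closed
  under sums without side conditions on cancellation.\<close>

definition val2_ge :: "int \<Rightarrow> rat \<Rightarrow> bool" where
  "val2_ge r x \<longleftrightarrow> x = 0 \<or> r \<le> val2 x"

lemma int_two_power_odd:
  assumes "(p::int) \<noteq> 0"
  obtains q where "odd q" "p = 2 ^ multiplicity 2 p * q"
proof -
  have "\<not> is_unit (2::int)" by simp
  then show ?thesis
    using multiplicity_decompose'[of p 2] assms that by blast
qed

lemma two_powi_split: "s \<le> t \<Longrightarrow> (2::rat) powi t = 2 powi s * 2 ^ nat (t - s)"
  using power_int_add[of "2::rat" s "int (nat (t - s))"] by (simp add: power_int_def[of _ "t - s"])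

lemma val2_decompose:
  assumes "x \<noteq> 0"
  obtains a b :: int where "odd a" "odd b" "x = 2 powi val2 x * of_int a / of_int b"
proof -
  obtain p q where pq: "quotient_of x = (p, q)" by force
  have q0: "q > 0" using quotient_of_denom_pos[OF pq] .
  have x: "x = of_int p / of_int q" using quotient_of_div[OF pq] .
  have p0: "p \<noteq> 0" using x assms by auto
  obtain a where a: "odd a" "p = 2 ^ multiplicity 2 p * a" using int_two_power_odd[OF p0] .
  obtain b where b: "odd b" "q = 2 ^ multiplicity 2 q * b" using int_two_power_odd[of q] q0 by auto
  have "x = (2 ^ multiplicity 2 p * of_int a) / (2 ^ multiplicity 2 q * of_int b)"
    using x a(2) b(2) by (metis of_int_mult of_int_numeral of_int_power)
  also have "\<dots> = 2 powi val2 x * of_int a / of_int b"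
    by (simp add: val2_def pq power_int_diff)
  finally show ?thesis using a b that by blast
qed

text \<open>Cross-multiplying two such representations with different exponents would equate an odd
  integer with an even one.\<close>

lemma val2_unique:
  assumes "odd a" "odd b" "x = 2 powi r * of_int a / of_int b"
  shows "x \<noteq> 0" "val2 x = r"
proof -
  have ab: "a \<noteq> 0" "b \<noteq> 0" using assms by auto
  show x0: "x \<noteq> 0" using assms ab by simp
  obtain c d :: int where cd: "odd c" "odd d" "x = 2 powi val2 x * of_int c / of_int d"
    using val2_decompose[OF x0] .
  have cd0: "c \<noteq> 0" "d \<noteq> 0" using cd by auto
  have eq: "2 powi r * of_int (a * d) = (2 powi val2 x * of_int (c * b) :: rat)"
  proof -
    have "2 powi r * of_int (a * d) = x * of_int b * of_int d" using assms(3) ab by simp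
    also have "\<dots> = (x * of_int d) * of_int b" by simp
    also have "x * of_int d = 2 powi val2 x * of_int c"
      using cd0 by (subst cd(3)) simp
    finally show ?thesis by simp
  qed
  have aux: False if "r' < s'" "odd u" "2 powi r' * of_int u = (2 powi s' * of_int v :: rat)"
    for r' s' u v :: int
  proof -
    have "2 powi s' = (2 powi r' * 2 ^ nat (s' - r') :: rat)"
      using that(1) by (intro two_powi_split) simp
    then have "(of_int u :: rat) = 2 ^ nat (s' - r') * of_int v"
      using that(3) by simp
    then have "(of_int u :: rat) = of_int (2 ^ nat (s' - r') * v)" by simp
    then have "u = 2 ^ nat (s' - r') * v" by (simp only: of_int_eq_iff)
    then show False using that by simp
  qed
  show "val2 x = r"
    using aux[of r "val2 x" "a * d" "c * b"] aux[of "val2 x" r "c * b" "a * d"] eq assms cd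
    by (cases "val2 x" r rule: linorder_cases) auto
qed

text \<open>This is the fractional ideal generated by \<open>2 powi r\<close> in the rationals with
  odd denominator; closure under addition becomes a computation with fractions.\<close>

lemma val2_ge_iff:
  "val2_ge r x \<longleftrightarrow> (\<exists>a b. odd b \<and> x = 2 powi r * of_int a / of_int b)"
proof
  assume *: "val2_ge r x"
  show "\<exists>a b. odd b \<and> x = 2 powi r * of_int a / of_int b"
  proof (cases "x = 0")
    case True
    then show ?thesis by (intro exI[of _ 0] exI[of _ 1]) auto
  next
    case False
    obtain a b :: int where ab: "odd a" "odd b" "x = 2 powi val2 x * of_int a / of_int b"
      using val2_decompose[OF False] .
    have "2 powi val2 x = (2 powi r * 2 ^ nat (val2 x - r) :: rat)"
      using * False by (intro two_powi_split) (simp add: val2_ge_def)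
    with ab show ?thesis
      by (intro exI[of _ "2 ^ nat (val2 x - r) * a"] exI[of _ b]) (simp add: field_simps)
  qed
next
  assume "\<exists>a b. odd b \<and> x = 2 powi r * of_int a / of_int b"
  then obtain a b where ab: "odd b" "x = 2 powi r * of_int a / of_int b" by blast
  show "val2_ge r x"
  proof (cases "a = 0")
    case True
    then show ?thesis using ab by (simp add: val2_ge_def)
  next
    case False
    obtain q where q: "odd q" "a = 2 ^ multiplicity 2 a * q" using int_two_power_odd[OF False] .
    have "x = 2 powi r * (2 ^ multiplicity 2 a * of_int q) / of_int b"
      using ab(2) q(2) by (metis of_int_mult of_int_numeral of_int_power)
    also have "\<dots> = 2 powi (r + int (multiplicity 2 a)) * of_int q / of_int b"
      by (simp add: power_int_add)
    finally show ?thesis using val2_unique[OF q(1) ab(1)] by (simp add: val2_ge_def)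
  qed
qed

lemma val2_mult:
  assumes "x \<noteq> 0" "y \<noteq> 0"
  shows "val2 (x * y) = val2 x + val2 y"
proof -
  obtain a b :: int where ab: "odd a" "odd b" "x = 2 powi val2 x * of_int a / of_int b"
    using val2_decompose[OF assms(1)] .
  obtain c d :: int where cd: "odd c" "odd d" "y = 2 powi val2 y * of_int c / of_int d"
    using val2_decompose[OF assms(2)] .
  have "x * y = (2 powi val2 x * of_int a / of_int b) * (2 powi val2 y * of_int c / of_int d)"
    using ab(3) cd(3) by simp
  also have "\<dots> = 2 powi (val2 x + val2 y) * of_int (a * c) / of_int (b * d)"
    by (simp add: power_int_add)
  finally show ?thesis using val2_unique(2)[of "a * c" "b * d"] ab cd by simp
qed

lemma val2_odd [simp]: "odd (a::int) \<Longrightarrow> val2 (of_int a) = 0"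
  using val2_unique(2)[of a 1 "of_int a" 0] by simp

lemma val2_one [simp]: "val2 1 = 0" and val2_two [simp]: "val2 2 = 1"
  using val2_unique(2)[of 1 1 1 0] val2_unique(2)[of 1 1 2 1] by simp_all

lemma val2_power: "x \<noteq> 0 \<Longrightarrow> val2 (x ^ j) = int j * val2 x"
  by (induction j) (simp_all add: val2_mult algebra_simps)

lemma val2_minus [simp]: "val2 (- x) = val2 x"
proof (cases "x = 0")
  case False
  have "val2 (of_int (-1) * x) = val2 (of_int (-1)) + val2 x"
    using False by (intro val2_mult) auto
  then show ?thesis using val2_odd[of "-1"] by simp
qed simp

lemma val2_inverse: "x \<noteq> 0 \<Longrightarrow> val2 (inverse x) = - val2 x"
  using val2_mult[of x "inverse x"] by simp

lemma val2_divide: "x \<noteq> 0 \<Longrightarrow> y \<noteq> 0 \<Longrightarrow> val2 (x / y) = val2 x - val2 y"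
  by (simp add: divide_inverse val2_mult val2_inverse)

lemma multiplicity_int_two: "multiplicity 2 (int a) = multiplicity 2 a"
proof -
  have "{k. 2 ^ k dvd int a} = {k. 2 ^ k dvd a}"
    by (metis of_nat_dvd_iff of_nat_numeral of_nat_power)
  then show ?thesis by (simp add: multiplicity_def)
qed

lemma val2_of_nat: "a > 0 \<Longrightarrow> val2 (of_nat a) = int (multiplicity 2 a)"
  by (simp add: val2_def multiplicity_int_two)

lemma val2_ge_0 [simp]: "val2_ge r 0"
  by (simp add: val2_ge_def)

lemma val2_ge_of_int [simp]: "val2_ge 0 (of_int a)"
  unfolding val2_ge_iff by (intro exI[of _ a] exI[of _ 1]) simp

lemma val2_ge_of_nat [simp]: "val2_ge 0 (of_nat a)"
  using val2_ge_of_int[of "int a"] by simp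

lemma val2_ge_mono: "val2_ge r x \<Longrightarrow> s \<le> r \<Longrightarrow> val2_ge s x"
  by (auto simp: val2_ge_def)

lemma val2_ge_minus_iff [simp]: "val2_ge r (- x) \<longleftrightarrow> val2_ge r x"
  by (simp add: val2_ge_def)

lemma val2_ge_mult: "val2_ge r x \<Longrightarrow> val2_ge s y \<Longrightarrow> val2_ge (r + s) (x * y)"
  by (cases "x = 0"; cases "y = 0") (auto simp: val2_ge_def val2_mult)

lemma val2_ge_mult_iff: "y \<noteq> 0 \<Longrightarrow> val2_ge r (x * y) \<longleftrightarrow> val2_ge (r - val2 y) x"
  by (cases "x = 0") (auto simp: val2_ge_def val2_mult)

lemma val2_ge_add:
  assumes "val2_ge r x" "val2_ge r y"
  shows "val2_ge r (x + y)"
proof -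
  obtain a b where ab: "odd b" "x = 2 powi r * of_int a / of_int b"
    using assms(1) val2_ge_iff by blast
  obtain c d where cd: "odd d" "y = 2 powi r * of_int c / of_int d"
    using assms(2) val2_ge_iff by blast
  have "b \<noteq> 0" "d \<noteq> 0" using ab cd by auto
  then have "x + y = 2 powi r * of_int (a * d + c * b) / of_int (b * d)"
    unfolding ab cd by (simp add: field_simps)
  then show ?thesis using ab cd unfolding val2_ge_iff
    by (intro exI[of _ "a * d + c * b"] exI[of _ "b * d"]) auto
qed

lemma val2_ge_diff: "val2_ge r x \<Longrightarrow> val2_ge r y \<Longrightarrow> val2_ge r (x - y)"
  using val2_ge_add[of r x "- y"] by simp

lemma val2_ge_sum: "(\<And>i. i \<in> A \<Longrightarrow> val2_ge r (f i)) \<Longrightarrow> val2_ge r (sum f A)"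
  by (induction A rule: infinite_finite_induct) (auto intro: val2_ge_add)

lemma val2_ge_add_cancel: "val2_ge r y \<Longrightarrow> val2_ge r (x + y) \<longleftrightarrow> val2_ge r x"
  using val2_ge_add[of r x y] val2_ge_diff[of r "x + y" y] by auto

text \<open>The residue field has two elements, so two terms of exact valuation \<open>r\<close>
  cancel to higher valuation. This is the source of the exclusive "or" in the theorem.\<close>

lemma val2_ge_Suc_add_iff:
  assumes "val2_ge r x" "val2_ge r y"
  shows "val2_ge (r + 1) (x + y) \<longleftrightarrow> (val2_ge (r + 1) x \<longleftrightarrow> val2_ge (r + 1) y)"
proof -
  have "val2_ge (r + 1) (x + y)" if "\<not> val2_ge (r + 1) x" "\<not> val2_ge (r + 1) y"
  proof -
    have x: "x \<noteq> 0" "val2 x = r" and y: "y \<noteq> 0" "val2 y = r"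
      using that assms by (auto simp: val2_ge_def)
    obtain a b :: int where ab: "odd a" "odd b" "x = 2 powi r * of_int a / of_int b"
      using val2_decompose[OF x(1)] x(2) by auto
    obtain c d :: int where cd: "odd c" "odd d" "y = 2 powi r * of_int c / of_int d"
      using val2_decompose[OF y(1)] y(2) by auto
    have "even (a * d + c * b)" using ab cd by auto
    then obtain e where e: "a * d + c * b = 2 * e" by blast
    have "b \<noteq> 0" "d \<noteq> 0" using ab cd by auto
    then have "x + y = 2 powi r * of_int (a * d + c * b) / of_int (b * d)"
      unfolding ab cd by (simp add: field_simps)
    also have "\<dots> = 2 powi (r + 1) * of_int e / of_int (b * d)"
      unfolding e by (simp add: power_int_add)
    finally show ?thesis using ab cd unfolding val2_ge_iff
      by (intro exI[of _ e] exI[of _ "b * d"]) auto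
  qed
  then show ?thesis
    using val2_ge_add_cancel[of "r + 1" y x] val2_ge_add_cancel[of "r + 1" x y]
    by (auto simp: add.commute)
qed

lemma nu2_eq_iff: "nu2 x = ereal (of_int r) \<longleftrightarrow> val2_ge r x \<and> \<not> val2_ge (r + 1) x"
  by (auto simp: nu2_def val2_ge_def)

lemma nu2_mult: "nu2 (x * y) = nu2 x + nu2 y"
  by (simp add: nu2_def val2_mult)

lemma nu2_le_iff: "y \<noteq> 0 \<Longrightarrow> nu2 x \<le> nu2 y \<longleftrightarrow> x \<noteq> 0 \<and> val2 x \<le> val2 y"
  by (auto simp: nu2_def)

section \<open>Binary digit sums and Legendre's formula\<close>

lemma sigma2_0 [simp]: "sigma2 0 = 0"
  by (subst sigma2.simps) simp

lemma sigma2_double [simp]: "sigma2 (2 * m) = sigma2 m"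
  by (cases "m = 0") (simp, subst sigma2.simps, simp)

lemma sigma2_Suc_double [simp]: "sigma2 (Suc (2 * m)) = Suc (sigma2 m)"
  by (subst sigma2.simps) simp

lemma sigma2_Suc_Suc_double [simp]: "sigma2 (Suc (Suc (2 * m))) = sigma2 (Suc m)"
  using sigma2_double[of "Suc m"] by simp

lemma sigma2_one [simp]: "sigma2 (Suc 0) = 1"
  using sigma2_Suc_double[of 0] by simp

lemma sigma2_small: "sigma2 2 = 1" "sigma2 3 = 2" "sigma2 4 = 1"
  using sigma2_double[of 1] sigma2_Suc_double[of 1] sigma2_double[of 2]
  by (simp_all add: numeral_3_eq_3)

text \<open>Adding 1 clears the trailing ones and sets the next digit; the number of cleared ones is
  the valuation of the successor.\<close>

lemma sigma2_Suc: "sigma2 (Suc m) + multiplicity 2 (Suc m) = Suc (sigma2 m)"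
proof (induction m rule: less_induct)
  case (less m)
  show ?case
  proof (cases "even m")
    case True
    then obtain j where "m = 2 * j" by blast
    then show ?thesis by (simp add: not_dvd_imp_multiplicity_0)
  next
    case False
    then obtain j where m: "m = Suc (2 * j)" using oddE by fastforce
    have e: "Suc m = 2 * Suc j" using m by simp
    have "multiplicity 2 (2 * Suc j) = Suc (multiplicity 2 (Suc j))"
      by (rule multiplicity_times_same) auto
    then show ?thesis unfolding e
      using less.IH[of j] m by simp
  qed
qed

text \<open>Strip the last digits and induct; only when both are 1 is there a carry, which costs at
  most one further digit.\<close>

lemma sigma2_add_le: "sigma2 (a + b) \<le> sigma2 a + sigma2 b"
proof (induction "a + b" arbitrary: a b rule: less_induct)
  case less
  obtain i x where a: "a = 2 * i + x" "x < 2" using that[of "a div 2" "a mod 2"] by simp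
  obtain j y where b: "b = 2 * j + y" "y < 2" using that[of "b div 2" "b mod 2"] by simp
  have ss: "sigma2 (Suc m) \<le> Suc (sigma2 m)" for m using sigma2_Suc[of m] by simp
  have ih: "sigma2 (i + j) \<le> sigma2 i + sigma2 j" if "a + b \<noteq> 0"
    by (rule less) (use that a b in auto)
  show ?case
  proof (cases "a + b = 0")
    case False
    from a(2) b(2) consider "x = 0" "y = 0" | "x = 0" "y = 1" | "x = 1" "y = 0" | "x = 1" "y = 1"
      by fastforce
    then show ?thesis
    proof cases
      case 1 then show ?thesis using ih[OF False] a b
        by (simp del: distrib_left_numeral flip: distrib_left)
    next
      case 2 then show ?thesis using ih[OF False] a b
        by (simp del: distrib_left_numeral flip: distrib_left)
    next
      case 3 then show ?thesis using ih[OF False] a b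
        by (simp del: distrib_left_numeral flip: distrib_left)
    next
      case 4 then show ?thesis using ih[OF False] ss[of "i + j"] a b
        by (simp del: distrib_left_numeral flip: distrib_left)
    qed
  qed simp
qed

lemma sigma2_le: "sigma2 m \<le> m"
proof (induction m)
  case (Suc m)
  then show ?case using sigma2_Suc[of m] by simp
qed simp

lemma sigma2_less: "m \<ge> 2 \<Longrightarrow> sigma2 m < m"
  using sigma2_add_le[of 2 "m - 2"] sigma2_le[of "m - 2"]
  by (simp add: sigma2_small del: add_2_eq_Suc)

lemma val2_fact: "val2 (fact m) = int m - int (sigma2 m)"
proof (induction m)
  case (Suc m)
  have "val2 (fact (Suc m)) = val2 (of_nat (Suc m) * fact m)" by simp
  also have "\<dots> = val2 (of_nat (Suc m)) + val2 (fact m)"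
    by (rule val2_mult) (auto simp del: of_nat_Suc)
  finally have "val2 (fact (Suc m)) = int (multiplicity 2 (Suc m)) + val2 (fact m)"
    by (simp add: val2_of_nat del: of_nat_Suc)
  then show ?case using Suc sigma2_Suc[of m] by simp
qed simp

section \<open>Powers of the logarithm series\<close>

text \<open>The series \<open>P\<close> and \<open>L = 1 - s P = log (1 + 2 s) / (2 s)\<close> of the introduction.\<close>

definition log_tail :: "rat fps" where
  "log_tail = Abs_fps (\<lambda>i. (-1) ^ i * 2 ^ (i + 1) / of_nat (i + 2))"

definition log_quot :: "rat fps" where
  "log_quot = 1 - fps_X * log_tail"

lemma log_quot_nth_0 [simp]: "log_quot $ 0 = 1"
  by (simp add: log_quot_def)

lemma log_tail_nth_0 [simp]: "log_tail $ 0 = 1" and log_tail_nth_2: "log_tail $ 2 = 2"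
  by (simp_all add: log_tail_def)

lemma multiplicity_two_less: "a > 0 \<Longrightarrow> multiplicity 2 (a::nat) < a"
  using dvd_imp_le[OF multiplicity_dvd[of 2 a]] less_exp[of "multiplicity 2 a"] by linarith

text \<open>For \<open>i = 2 * j\<close> with \<open>j\<close> at least 2, the first term is at most
  \<open>1 + j\<close> and the second at most \<open>j - 1\<close>. At the excluded values 0 and 2
  the bound fails by one.\<close>

lemma multiplicity_add_sigma2_le:
  assumes "i \<noteq> 0" "i \<noteq> 2"
  shows "multiplicity 2 (i + 2) + sigma2 i \<le> i"
proof (cases "even i")
  case True
  then obtain j where j: "i = 2 * j" by blast
  have e: "i + 2 = 2 * Suc j" using j by simp
  have "multiplicity 2 (2 * Suc j) = Suc (multiplicity 2 (Suc j))"
    by (rule multiplicity_times_same) auto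
  then show ?thesis
    using multiplicity_two_less[of "Suc j"] sigma2_less[of j] assms unfolding e by (simp add: j)
next
  case False
  then show ?thesis using sigma2_le[of i] by (simp add: not_dvd_imp_multiplicity_0)
qed

lemma val2_ge_log_tail:
  assumes "i \<noteq> 0" "i \<noteq> 2"
  shows "val2_ge (int (sigma2 i) + 1) (log_tail $ i)"
proof -
  have "val2 (2 ^ (i + 1) / of_nat (i + 2)) = int (i + 1) - int (multiplicity 2 (i + 2))"
    using val2_divide[of "2 ^ (i + 1)" "of_nat (i + 2)"] val2_of_nat[of "i + 2"] val2_power[of 2 "i + 1"]
    by simp
  then have "val2_ge (int (sigma2 i) + 1) (2 ^ (i + 1) / of_nat (i + 2))"
    using multiplicity_add_sigma2_le[OF assms] by (simp add: val2_ge_def)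
  then show ?thesis
    by (cases "even i") (simp_all add: log_tail_def)
qed

lemma val2_ge_log_tail_weak: "val2_ge (int (sigma2 i)) (log_tail $ i)"
proof (cases "i = 0 \<or> i = 2")
  case True
  then show ?thesis by (auto simp: log_tail_nth_2 sigma2_small val2_ge_def)
next
  case False
  then show ?thesis using val2_ge_log_tail[of i] val2_ge_mono by simp
qed

text \<open>Subadditivity of \<sigma> makes this coefficientwise bound stable under products of
  series.\<close>

lemma val2_ge_log_tail_power_weak: "val2_ge (int (sigma2 i)) ((log_tail ^ j) $ i)"
proof (induction j arbitrary: i)
  case 0
  then show ?case by (cases "i = 0") (auto simp: val2_ge_def)
next
  case (Suc j)
  have "val2_ge (int (sigma2 i)) (log_tail $ a * (log_tail ^ j) $ (i - a))" if "a \<le> i" for a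
    using val2_ge_mult[OF val2_ge_log_tail_weak[of a] Suc[of "i - a"]] sigma2_add_le[of a "i - a"] that
    by (elim val2_ge_mono) simp
  then show ?case by (auto simp: fps_mult_nth intro!: val2_ge_sum)
qed

lemma log_tail_power_nth_0 [simp]: "(log_tail ^ j) $ 0 = 1"
  by (simp add: fps_power_zeroth)

text \<open>A product of coefficients gains the extra 1 as soon as one factor has an index other
  than 0 and 2. The remaining case 2 + 2 gains it because \<sigma> drops from 1 + 1 to \<sigma>(4) =
  1.\<close>

lemma val2_ge_log_tail_power:
  assumes "i \<noteq> 0" "i \<noteq> 2"
  shows "val2_ge (int (sigma2 i) + 1) ((log_tail ^ j) $ i)"
  using assms
proof (induction j arbitrary: i)
  case 0
  then show ?case by simp
next
  case (Suc j)
  have "val2_ge (int (sigma2 i) + 1) (log_tail $ a * (log_tail ^ j) $ (i - a))" if a: "a \<le> i" for a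
  proof -
    have s: "sigma2 i \<le> sigma2 a + sigma2 (i - a)" using sigma2_add_le[of a "i - a"] a by simp
    consider "a = 0" | "a \<noteq> 0" "a \<noteq> 2" | "a = 2" "i - a = 2" | "a = 2" "i - a \<noteq> 0" "i - a \<noteq> 2"
      using Suc.prems a by linarith
    then show ?thesis
    proof cases
      case 1
      then show ?thesis using Suc by simp
    next
      case 2
      show ?thesis
        using val2_ge_mult[OF val2_ge_log_tail[OF 2] val2_ge_log_tail_power_weak[of "i - a" j]] s
        by (elim val2_ge_mono) simp
    next
      case 3
      then have "i = 4" by simp
      then show ?thesis
        using val2_ge_mult[OF val2_ge_log_tail_weak[of a] val2_ge_log_tail_power_weak[of "i - a" j]] 3
        by (simp add: sigma2_small)
    next
      case 4
      show ?thesis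
        using val2_ge_mult[OF val2_ge_log_tail_weak[of a] Suc.IH[OF 4(2,3)]] s
        by (elim val2_ge_mono) simp
    qed
  qed
  then show ?case by (auto simp: fps_mult_nth intro!: val2_ge_sum)
qed

text \<open>Each factor contributes its own coefficient 2; the cross terms are products of two
  linear coefficients and vanish modulo 4.\<close>

lemma val2_ge_log_tail_power_nth_2: "val2_ge 2 ((log_tail ^ j) $ 2 - 2 * of_nat j)"
proof (induction j)
  case 0
  then show ?case by simp
next
  case (Suc j)
  have "{0..2::nat} = {0, 1, 2}" by auto
  then have e: "(log_tail ^ Suc j) $ 2 - 2 * of_nat (Suc j)
      = ((log_tail ^ j) $ 2 - 2 * of_nat j) + log_tail $ Suc 0 * (log_tail ^ j) $ Suc 0"
    by (simp add: fps_mult_nth log_tail_nth_2)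
  have "val2_ge (1 + 1) (log_tail $ Suc 0 * (log_tail ^ j) $ Suc 0)"
    by (rule val2_ge_mult[OF val2_ge_mono[OF val2_ge_log_tail] val2_ge_mono[OF val2_ge_log_tail_power]]) auto
  then show ?case unfolding e using Suc by (auto intro: val2_ge_add)
qed

section \<open>Negative powers of the logarithm series by the negative binomial series\<close>

lemma one_minus_X_power_mult_choose:
  "(1 - fps_X) ^ Suc n * Abs_fps (\<lambda>j. of_nat ((n + j) choose n)) = (1 :: rat fps)"
proof (induction n)
  case 0
  show ?case
    by (rule fps_ext) (simp add: algebra_simps fps_X_mult_nth)
next
  case (Suc n)
  have "(1 - fps_X) * Abs_fps (\<lambda>j. of_nat ((Suc n + j) choose Suc n))
      = (Abs_fps (\<lambda>j. of_nat ((n + j) choose n)) :: rat fps)"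
  proof (rule fps_ext)
    fix j
    show "((1 - fps_X) * Abs_fps (\<lambda>j. of_nat ((Suc n + j) choose Suc n))) $ j
      = (Abs_fps (\<lambda>j. of_nat ((n + j) choose n)) :: rat fps) $ j"
      by (cases j) (simp_all add: left_diff_distrib fps_X_mult_nth)
  qed
  then have "(1 - fps_X) ^ Suc n * ((1 - fps_X) * Abs_fps (\<lambda>j. of_nat ((Suc n + j) choose Suc n))) = (1 :: rat fps)"
    using Suc by (simp only:)
  then show ?case by (simp only: power_Suc2[of _ "Suc n"] mult.assoc)
qed

text \<open>Substituting \<open>s P\<close> for the variable turns \<open>1 - X\<close> into
  \<open>L\<close>, and the preceding product identity survives composition.\<close>

lemma inverse_log_quot_power:
  "inverse log_quot ^ Suc n = Abs_fps (\<lambda>j. of_nat ((n + j) choose n)) oo (fps_X * log_tail)"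
  (is "_ = ?B oo ?Z")
proof -
  have z: "?Z $ 0 = 0" by simp
  have "((1 - fps_X) ^ Suc n * ?B) oo ?Z = (1 - ?Z) ^ Suc n * (?B oo ?Z)"
    by (simp only: fps_compose_mult_distrib[OF z] fps_compose_power[OF z, symmetric]
          fps_compose_sub_distrib fps_X_fps_compose_startby0[OF z] fps_compose_1)
  then have "1 = log_quot ^ Suc n * (?B oo ?Z)"
    by (simp only: one_minus_X_power_mult_choose fps_compose_1 log_quot_def)
  moreover have inv: "inverse log_quot * log_quot = 1"
    by (rule inverse_mult_eq_1) simp
  ultimately have "inverse log_quot ^ Suc n = (inverse log_quot ^ Suc n * log_quot ^ Suc n) * (?B oo ?Z)"
    by (simp only: mult.assoc mult_1_right)
  also have "\<dots> = ?B oo ?Z"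
    by (simp only: inv power_one mult_1 flip: power_mult_distrib)
  finally show ?thesis .
qed

lemma inverse_log_quot_power_nth:
  "(inverse log_quot ^ Suc n) $ w
    = (\<Sum>j\<le>w. of_nat ((n + j) choose n) * (log_tail ^ j) $ (w - j))"
  unfolding inverse_log_quot_power
  by (simp add: fps_compose_nth power_mult_distrib fps_X_power_mult_nth atLeast0AtMost cong: sum.cong_simp)

section \<open>Powers of the exponential series\<close>

lemma log_quot_nth: "log_quot $ i = (-2) ^ i / of_nat (i + 1)"
  by (cases i) (simp_all add: log_quot_def log_tail_def power_minus[of 2])

text \<open>The derivative of \<open>s L = log (1 + 2 s) / 2\<close> is
  \<open>1 / (1 + 2 s)\<close>; here the denominator is cleared.\<close>

lemma log_quot_deriv: "(1 + 2 * fps_X) * (fps_X * fps_deriv log_quot) = 1 - (1 + 2 * fps_X) * log_quot"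
proof -
  have "fps_X * fps_deriv log_quot + log_quot = Abs_fps (\<lambda>i. (-2) ^ i)"
    by (rule fps_ext) (auto simp: log_quot_nth field_simps add_eq_0_iff_both_eq_0 simp flip: of_nat_Suc, simp_all add: algebra_simps)
  moreover have "(1 + 2 * fps_X) * Abs_fps (\<lambda>i. (-2) ^ i) = (1 :: rat fps)"
  proof (rule fps_ext)
    fix i
    show "((1 + 2 * fps_X) * Abs_fps (\<lambda>i. (-2) ^ i)) $ i = (1 :: rat fps) $ i"
      by (cases i) (simp_all add: distrib_right mult.assoc numeral_fps_const)
  qed
  ultimately show ?thesis by (metis add_diff_cancel_right' distrib_left)
qed

text \<open>Differentiate the power of \<open>1 / L\<close>, insert the differential equation of
  \<open>L\<close>, and compare coefficients of \<open>s^(v+1)\<close>.\<close>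

lemma inverse_log_quot_power_rec:
  "of_nat (n + 1) * (inverse log_quot ^ (n + 2)) $ (v + 1)
    = (of_nat n - of_nat v) * (inverse log_quot ^ (n + 1)) $ (v + 1)
      + 2 * (of_nat n + 1 - of_nat v) * (inverse log_quot ^ (n + 1)) $ v"
proof -
  define W where "W = inverse log_quot"
  have inv: "log_quot * W = 1"
    unfolding W_def by (rule inverse_mult_eq_1') simp
  have "fps_deriv (W ^ (n + 1)) = - of_nat (n + 1) * fps_deriv log_quot * W ^ (n + 2)"
    unfolding fps_deriv_power' by (simp add: W_def fps_inverse_deriv algebra_simps power2_eq_square)
  then have "(1 + 2 * fps_X) * (fps_X * fps_deriv (W ^ (n + 1)))
      = - of_nat (n + 1) * ((1 + 2 * fps_X) * (fps_X * fps_deriv log_quot)) * W ^ (n + 2)"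
    by (simp add: mult_ac)
  also have "\<dots> = - of_nat (n + 1) * W ^ (n + 2) + of_nat (n + 1) * (1 + 2 * fps_X) * (log_quot * W) * W ^ (n + 1)"
    unfolding log_quot_deriv by (simp add: algebra_simps)
  finally have eq: "fps_X * fps_deriv (W ^ (n + 1)) + fps_const 2 * (fps_X * (fps_X * fps_deriv (W ^ (n + 1))))
      = fps_const (- of_nat (n + 1)) * W ^ (n + 2) + fps_const (of_nat (n + 1)) * (W ^ (n + 1) + fps_const 2 * (fps_X * W ^ (n + 1)))"
    unfolding inv by (simp add: algebra_simps numeral_fps_const flip: fps_of_nat)
  \<comment> \<open>Coefficients are extracted for arbitrary \<open>g\<close> and \<open>h\<close>,
    so that the powers stay opaque to the simplifier.\<close>
  have coeff: "of_nat (n + 1) * h $ (v + 1)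
      = (of_nat n - of_nat v) * g $ (v + 1) + 2 * (of_nat n + 1 - of_nat v) * g $ v"
    if "fps_X * fps_deriv g + fps_const 2 * (fps_X * (fps_X * fps_deriv g))
      = fps_const (- of_nat (n + 1)) * h + fps_const (of_nat (n + 1)) * (g + fps_const 2 * (fps_X * g))"
    for g h :: "rat fps"
    using arg_cong[OF that, of "\<lambda>f. f $ (v + 1)"] by (cases v) (simp_all add: algebra_simps)
  show ?thesis
    using coeff[OF eq] by (simp only: W_def)
qed

text \<open>The operator \<open>t d/dt + c\<close> acts diagonally on monomials; this turns the
  differential equations below into recurrences.\<close>

lemma euler_operator_nth:
  fixes f g :: "'a :: comm_ring_1 fps"
  assumes "fps_X * fps_deriv f + of_nat c * f = g"
  shows "of_nat (c + m) * f $ m = g $ m"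
  unfolding assms[symmetric] by (cases m) (simp_all add: algebra_simps flip: fps_of_nat)

section \<open>The series \<open>F = (e^t - 1) / t\<close> and its powers\<close>

definition exp_quot :: "rat fps" where
  "exp_quot = Abs_fps (\<lambda>j. 1 / fact (j + 1))"

lemma exp_quot_nth_0 [simp]: "exp_quot $ 0 = 1"
  by (simp add: exp_quot_def)

lemma X_mult_exp_quot: "fps_X * exp_quot = fps_exp 1 - 1"
proof (rule fps_ext)
  fix i
  show "(fps_X * exp_quot) $ i = (fps_exp 1 - 1) $ i"
    by (cases i) (simp_all add: exp_quot_def algebra_simps)
qed

lemma inverse_bern_gen: "inverse bern_gen = exp_quot"
proof -
  have "bern_gen = fps_X / (fps_X * exp_quot)"
    by (simp add: bern_gen_def X_mult_exp_quot)
  also have "\<dots> = 1 / exp_quot"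
    using div_mult_mult1[of fps_X 1 exp_quot] by simp
  finally have "bern_gen = inverse exp_quot" by (simp add: fps_divide_unit)
  then show ?thesis using fps_inverse_idempotent[of exp_quot] by simp
qed

lemma exp_quot_deriv: "fps_X * fps_deriv exp_quot = fps_exp 1 - exp_quot"
  using arg_cong[OF X_mult_exp_quot, of fps_deriv] by (simp add: algebra_simps)

text \<open>The relation \<open>e^t = 1 + t F\<close> eliminates the exponential, leaving only
  powers of \<open>F\<close>.\<close>

lemma exp_quot_power_deriv:
  "fps_X * fps_deriv (exp_quot ^ Suc k) =
    of_nat (Suc k) * (exp_quot ^ k + fps_X * exp_quot ^ Suc k - exp_quot ^ Suc k)"
proof -
  have "fps_X * fps_deriv (exp_quot ^ Suc k)
      = of_nat (Suc k) * exp_quot ^ k * (fps_X * fps_deriv exp_quot)"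
    by (simp add: fps_deriv_power' mult_ac del: power_Suc of_nat_Suc)
  also have "fps_X * fps_deriv exp_quot = 1 + fps_X * exp_quot - exp_quot"
    by (simp add: exp_quot_deriv X_mult_exp_quot)
  finally show ?thesis by (simp add: algebra_simps del: of_nat_Suc)
qed

definition exp_mult_quot_power :: "nat \<Rightarrow> rat fps" where
  "exp_mult_quot_power k = fps_exp 1 * exp_quot ^ k"

lemma exp_mult_quot_power_nth_0 [simp]: "exp_mult_quot_power k $ 0 = 1"
  by (simp add: exp_mult_quot_power_def fps_power_zeroth)

lemma exp_mult_quot_power_deriv:
  "fps_X * fps_deriv (exp_mult_quot_power (Suc k)) + of_nat (Suc k) * exp_mult_quot_power (Suc k)
    = of_nat (Suc k + 1) * (fps_X * exp_mult_quot_power (Suc k)) + of_nat (Suc k) * exp_mult_quot_power k"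
proof -
  have "fps_X * fps_deriv (exp_mult_quot_power (Suc k))
      = fps_X * exp_mult_quot_power (Suc k) + fps_exp 1 * (fps_X * fps_deriv (exp_quot ^ Suc k))"
    by (simp add: exp_mult_quot_power_def algebra_simps del: power_Suc)
  then show ?thesis
    unfolding exp_quot_power_deriv by (simp add: exp_mult_quot_power_def algebra_simps)
qed

text \<open>For \<open>k = 0\<close> the truncated \<open>k - 1\<close> is harmless, because its
  term carries the factor \<open>of_nat k\<close>.\<close>

lemma exp_mult_quot_power_rec:
  "of_nat (k + v + 1) * exp_mult_quot_power k $ (v + 1)
    = of_nat (k + 1) * exp_mult_quot_power k $ v + of_nat k * exp_mult_quot_power (k - 1) $ (v + 1)"
proof (cases k)
  case 0
  have "fact (v + 1) = of_nat (v + 1) * (fact v :: rat)" by simp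
  then show ?thesis using 0 by (simp add: exp_mult_quot_power_def del: fact_Suc of_nat_Suc)
next
  case (Suc k')
  show ?thesis unfolding Suc
    using euler_operator_nth[OF exp_mult_quot_power_deriv[of k'], of "v + 1"]
    by (simp add: add_ac del: of_nat_Suc of_nat_add flip: fps_of_nat)
qed

text \<open>A form of Lagrange inversion: after scaling by \<open>2 ^ w\<close>, the two coefficient
  recurrences coincide, so induction on \<open>n\<close> applies.\<close>

lemma inverse_log_quot_power_nth_eq:
  "w \<le> n \<Longrightarrow> (inverse log_quot ^ (n + 1)) $ w = 2 ^ w * exp_mult_quot_power (n - w) $ w"
proof (induction n arbitrary: w)
  case 0
  then show ?case by simp
next
  case (Suc n)
  show ?case
  proof (cases w)
    case 0
    then show ?thesis by (simp add: fps_power_zeroth)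
  next
    case v: (Suc v)
    define k where "k = n - v"
    have vk: "v \<le> n" "n = k + v" using Suc.prems v by (auto simp: k_def)
    have 1: "(inverse log_quot ^ (n + 1)) $ v = 2 ^ v * exp_mult_quot_power k $ v"
      using Suc.IH[OF vk(1)] by (simp add: k_def)
    have 2: "of_nat k * (inverse log_quot ^ (n + 1)) $ (v + 1)
        = of_nat k * (2 ^ (v + 1) * exp_mult_quot_power (k - 1) $ (v + 1))"
    proof (cases "k = 0")
      case False
      then have "v + 1 \<le> n" "n - (v + 1) = k - 1" using vk by auto
      then show ?thesis using Suc.IH[of "v + 1"] by simp
    qed simp
    have "of_nat (n + 1) * (inverse log_quot ^ (n + 2)) $ (v + 1)
        = of_nat k * (inverse log_quot ^ (n + 1)) $ (v + 1)
          + 2 * of_nat (k + 1) * (inverse log_quot ^ (n + 1)) $ v"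
      unfolding inverse_log_quot_power_rec using vk by simp
    also have "\<dots> = 2 ^ (v + 1) * (of_nat k * exp_mult_quot_power (k - 1) $ (v + 1)
        + of_nat (k + 1) * exp_mult_quot_power k $ v)"
      unfolding 1 2 by (simp add: algebra_simps)
    also have "\<dots> = of_nat (n + 1) * (2 ^ (v + 1) * exp_mult_quot_power k $ (v + 1))"
    proof -
      have "of_nat k * exp_mult_quot_power (k - 1) $ (v + 1) + of_nat (k + 1) * exp_mult_quot_power k $ v
          = of_nat (n + 1) * exp_mult_quot_power k $ (v + 1)"
        using exp_mult_quot_power_rec[of k v] vk(2) by (simp only: add.commute)
      then show ?thesis by (simp only: mult.left_commute)
    qed
    finally show ?thesis using v by (simp add: k_def del: of_nat_Suc of_nat_add power_Suc)
  qed
qed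

text \<open>With denominators cleared, the Stirling recurrence matches the coefficient recurrence
  given by the differential equation of the powers of \<open>F\<close>.\<close>

lemma of_nat_Stirling:
  "of_nat (Stirling (k + m) k) = of_nat ((k + m) choose k) * fact m * (exp_quot ^ k) $ m"
proof -
  have "of_nat (Stirling (k + m) k) * fact k = fact (k + m) * (exp_quot ^ k) $ m"
  proof (induction "k + m" arbitrary: k m)
    case 0
    then show ?case by simp
  next
    case (Suc n)
    show ?case
    proof (cases k)
      case 0
      then show ?thesis using Suc by (cases m) auto
    next
      case k: (Suc j)
      have n: "n = j + m" using Suc.hyps(2) k by simp
      have r: "of_nat (Suc n) * (exp_quot ^ Suc j) $ m
          = of_nat (Suc j) * ((exp_quot ^ j) $ m + (fps_X * exp_quot ^ Suc j) $ m)"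
        using euler_operator_nth[of "exp_quot ^ Suc j" "Suc j" "of_nat (Suc j) * (exp_quot ^ j + fps_X * exp_quot ^ Suc j)" m] n
        by (simp add: exp_quot_power_deriv right_diff_distrib del: of_nat_Suc of_nat_add power_Suc fps_X_mult_nth flip: fps_of_nat)
      have a: "of_nat (Stirling n (Suc j)) * fact (Suc j) = fact n * (fps_X * exp_quot ^ Suc j) $ m"
      proof (cases m)
        case 0
        then show ?thesis using n by simp
      next
        case (Suc i)
        then show ?thesis using Suc.hyps(1)[of "Suc j" i] n by simp
      qed
      have b: "of_nat (Stirling n j) * fact j = fact n * (exp_quot ^ j) $ m"
        using Suc.hyps(1)[of j m] n by simp
      have "(of_nat (Stirling (Suc n) (Suc j)) :: rat) * fact (Suc j)
          = of_nat (Suc j) * (of_nat (Stirling n (Suc j)) * fact (Suc j) + of_nat (Stirling n j) * fact j)"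
        by (simp add: algebra_simps)
      also have "\<dots> = fact n * (of_nat (Suc n) * (exp_quot ^ Suc j) $ m)"
        unfolding a b r by (simp add: algebra_simps)
      finally show ?thesis using n k by (simp add: mult_ac del: Stirling.simps)
    qed
  qed
  moreover have "of_nat ((k + m) choose k) * (fact k * fact m) = (fact (k + m) :: rat)"
    using binomial_fact[of k "k + m", where 'a = rat] by simp
  ultimately have "of_nat (Stirling (k + m) k) * fact k
      = (of_nat ((k + m) choose k) * fact m * (exp_quot ^ k) $ m) * fact k"
    by (simp add: mult_ac)
  then show ?thesis by simp
qed

text \<open>As \<open>F^k + t F^(k+1) = e^t F^k\<close>, the differential equation of
  \<open>F^(k+1)\<close> relates its coefficients to those of \<open>e^t F^k\<close>; absorption of
  the binomial cancels the factors.\<close>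

lemma of_nat_Stirling_Suc:
  "of_nat (Stirling (k + m + 1) (k + 1)) = of_nat ((k + m) choose k) * fact m * exp_mult_quot_power k $ m"
proof -
  have E: "fps_exp 1 = 1 + fps_X * exp_quot"
    by (simp add: X_mult_exp_quot)
  have "fps_X * fps_deriv (exp_quot ^ Suc k) + of_nat (Suc k) * exp_quot ^ Suc k
      = of_nat (Suc k) * exp_mult_quot_power k"
    unfolding exp_quot_power_deriv exp_mult_quot_power_def
    using E by (simp add: algebra_simps)
  from euler_operator_nth[OF this, of m]
  have e: "of_nat (k + m + 1) * (exp_quot ^ (k + 1)) $ m = of_nat (k + 1) * exp_mult_quot_power k $ m"
    by (simp add: add_ac del: of_nat_Suc of_nat_add power_Suc flip: fps_of_nat)
  have "(k + 1) * ((k + 1 + m) choose (k + 1)) = (k + m + 1) * ((k + m) choose k)"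
    using Suc_times_binomial[of k "k + m"] by simp
  then have c: "of_nat (k + 1) * (of_nat ((k + 1 + m) choose (k + 1)) :: rat)
      = of_nat (k + m + 1) * of_nat ((k + m) choose k)"
    by (metis of_nat_mult)
  have "of_nat (k + 1) * of_nat (Stirling (k + 1 + m) (k + 1))
      = (of_nat (k + 1) * of_nat ((k + 1 + m) choose (k + 1))) * fact m * (exp_quot ^ (k + 1)) $ m"
    by (simp only: of_nat_Stirling mult_ac)
  also have "\<dots> = of_nat ((k + m) choose k) * fact m * (of_nat (k + m + 1) * (exp_quot ^ (k + 1)) $ m)"
    unfolding c by (simp only: mult_ac)
  also have "\<dots> = of_nat (k + 1) * (of_nat ((k + m) choose k) * fact m * exp_mult_quot_power k $ m)"
    unfolding e by (simp only: mult_ac)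
  finally show ?thesis by (simp add: add_ac del: of_nat_Suc of_nat_add Stirling.simps binomial_Suc_Suc)
qed

section \<open>Coefficientwise valuations of polynomials\<close>

definition coeffs_ge :: "int \<Rightarrow> rat poly \<Rightarrow> bool" where
  "coeffs_ge r f \<longleftrightarrow> (\<forall>i. val2_ge r (coeff f i))"

text \<open>Zero coefficients impose no condition, and a nonzero \<open>f\<close> makes the set
  under \<open>Min\<close> nonempty.\<close>

lemma coeffs_ge_iff_max_pole:
  assumes "f \<noteq> 0"
  shows "coeffs_ge r f \<longleftrightarrow> r \<le> - max_pole f"
proof -
  have "coeffs_ge r f \<longleftrightarrow> (\<forall>c \<in> range (coeff f) - {0}. r \<le> val2 c)"
    unfolding coeffs_ge_def val2_ge_def by blast
  also have "range (coeff f) - {0} = set (coeffs f) - {0}"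
    by (simp add: range_coeff)
  also have "(\<forall>c \<in> set (coeffs f) - {0}. r \<le> val2 c) \<longleftrightarrow> r \<le> Min (val2 ` (set (coeffs f) - {0}))"
  proof (subst Min_ge_iff)
    have "coeff f (degree f) \<in> set (coeffs f) - {0}"
      using assms range_coeff[of f] by (metis Diff_iff insertE leading_coeff_0_iff rangeI singletonD)
    then show "val2 ` (set (coeffs f) - {0}) \<noteq> {}" by blast
  qed auto
  finally show ?thesis by (simp add: max_pole_def)
qed

lemma coeffs_ge_mult: "coeffs_ge r f \<Longrightarrow> coeffs_ge s g \<Longrightarrow> coeffs_ge (r + s) (f * g)"
  by (auto simp: coeffs_ge_def coeff_mult intro!: val2_ge_sum val2_ge_mult)

text \<open>This is \<open>j!\<close> times the binomial coefficient of \<open>x - 1\<close> over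
  \<open>j\<close>; the shift by 1 makes evaluation at 1 isolate the constant term of an
  expansion.\<close>

definition falling_poly :: "nat \<Rightarrow> rat poly" where
  "falling_poly j = (\<Prod>i<j. [:- of_nat (Suc i), 1:])"

lemma coeffs_ge_falling_poly: "coeffs_ge 0 (falling_poly j)"
proof (induction j)
  case 0
  then show ?case by (auto simp: falling_poly_def coeffs_ge_def val2_ge_def coeff_1)
next
  case (Suc j)
  have "val2_ge 0 (- 1 - of_nat j)"
    using val2_ge_of_int[of "- 1 - int j"] by simp
  then have "coeffs_ge 0 [:- of_nat (Suc j), 1:]"
    by (auto simp: coeffs_ge_def coeff_pCons val2_ge_def split: nat.split)
  from coeffs_ge_mult[OF Suc this] show ?case
    by (simp add: falling_poly_def del: of_nat_Suc)
qed

lemma degree_falling_poly: "degree (falling_poly j) = j"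
  unfolding falling_poly_def by (subst degree_prod_eq_sum_degree) auto

lemma coeff_falling_poly_self: "coeff (falling_poly j) j = 1"
proof -
  have "lead_coeff (falling_poly j) = 1"
    unfolding falling_poly_def by (simp add: lead_coeff_prod)
  then show ?thesis by (simp add: degree_falling_poly)
qed

lemma poly_falling_poly: "poly (falling_poly j) (1 + x) = fact j * (x gchoose j)"
  by (simp add: falling_poly_def gbinomial_prod_rev poly_prod atLeast0LessThan algebra_simps)

text \<open>The basis is monic with integral coefficients, so the change of basis is unitriangular:
  read off the top coefficient, subtract its term, and induct.\<close>

lemma coeffs_ge_falling_sum_iff:
  "coeffs_ge r (\<Sum>j\<le>m. smult (a j) (falling_poly j)) \<longleftrightarrow> (\<forall>j\<le>m. val2_ge r (a j))"
proof
  show "coeffs_ge r (\<Sum>j\<le>m. smult (a j) (falling_poly j))" if "\<forall>j\<le>m. val2_ge r (a j)"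
    using that val2_ge_mult[of r _ 0] coeffs_ge_falling_poly
    by (auto simp: coeffs_ge_def coeff_sum intro!: val2_ge_sum)
  show "coeffs_ge r (\<Sum>j\<le>m. smult (a j) (falling_poly j)) \<Longrightarrow> \<forall>j\<le>m. val2_ge r (a j)"
  proof (induction m)
    case 0
    then show ?case by (auto simp: coeffs_ge_def falling_poly_def dest: spec[of _ 0])
  next
    case (Suc m)
    have "coeff (falling_poly j) (Suc m) = 0" if "j \<le> m" for j
      using that by (simp add: coeff_eq_0 degree_falling_poly)
    then have "coeff (\<Sum>j\<le>Suc m. smult (a j) (falling_poly j)) (Suc m) = a (Suc m)"
      by (simp add: coeff_sum coeff_falling_poly_self)
    then have top: "val2_ge r (a (Suc m))"
      using Suc.prems by (metis coeffs_ge_def)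
    have "val2_ge r (coeff (\<Sum>j\<le>m. smult (a j) (falling_poly j)) i)" for i
    proof -
      have "coeff (\<Sum>j\<le>m. smult (a j) (falling_poly j)) i
          = coeff (\<Sum>j\<le>Suc m. smult (a j) (falling_poly j)) i - a (Suc m) * coeff (falling_poly (Suc m)) i"
        by simp
      then show ?thesis
        using Suc.prems top coeffs_ge_falling_poly val2_ge_mult[of r "a (Suc m)" 0]
        by (metis add_0_right coeffs_ge_def val2_ge_diff)
    qed
    then have "\<forall>j\<le>m. val2_ge r (a j)"
      using Suc.IH by (simp add: coeffs_ge_def)
    with top show ?case by (auto simp: le_Suc_eq)
  qed
qed

section \<open>Newton expansion of the Bernoulli polynomials\<close>

lemma poly_eqI_of_nat:
  fixes p q :: "rat poly"
  assumes "\<And>N::nat. poly p (1 + of_nat N) = poly q (1 + of_nat N)"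
  shows "p = q"
proof (rule ccontr)
  assume "p \<noteq> q"
  then have "finite {x. poly (p - q) x = 0}" by (intro poly_roots_finite) simp
  moreover have "range (\<lambda>N::nat. 1 + of_nat N) \<subseteq> {x. poly (p - q) x = 0}"
    using assms by auto
  moreover have "inj (\<lambda>N::nat. 1 + of_nat N :: rat)" by (auto intro: injI)
  ultimately show False using finite_subset finite_imageD infinite_UNIV_nat by blast
qed

lemma poly_ho_bernpoly:
  "poly (ho_bernpoly m (- int k)) x = fact m * (exp_quot ^ k * fps_exp x) $ m"
proof -
  have "bern_gen powi (- int k) = exp_quot ^ k"
    by (cases "k = 0") (simp_all add: power_int_def inverse_bern_gen)
  then show ?thesis
    using arg_cong[OF ho_bernpoly_generating_function[of "- int k" x], of "\<lambda>f. f $ m"]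
    by (simp add: field_simps)
qed

text \<open>At \<open>x = 1 + N\<close> the exponential is \<open>e^t (1 + t F)^N\<close>, a finite
  binomial sum; agreement at all natural \<open>N\<close> suffices.\<close>

lemma ho_bernpoly_eq_falling_sum:
  "ho_bernpoly m (- int k)
    = (\<Sum>j\<le>m. smult (fact m / fact j * exp_mult_quot_power (k + j) $ (m - j)) (falling_poly j))"
proof (rule poly_eqI_of_nat)
  fix N :: nat
  have "fps_exp (1 + of_nat N) = fps_exp 1 * (fps_X * exp_quot + 1) ^ N"
    by (simp add: fps_exp_add_mult fps_exp_power_mult X_mult_exp_quot)
  also have "\<dots> = fps_exp 1 * (\<Sum>j\<le>N. of_nat (N choose j) * (fps_X * exp_quot) ^ j)"
    by (simp add: binomial_ring)
  finally have "exp_quot ^ k * fps_exp (1 + of_nat N)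
      = (\<Sum>j\<le>N. of_nat (N choose j) * (fps_X ^ j * exp_mult_quot_power (k + j)))"
    by (simp add: sum_distrib_left exp_mult_quot_power_def power_mult_distrib power_add mult_ac)
  then have "(exp_quot ^ k * fps_exp (1 + of_nat N)) $ m
      = (\<Sum>j\<le>N. of_nat (N choose j) * (fps_X ^ j * exp_mult_quot_power (k + j)) $ m)"
    by (simp add: fps_sum_nth flip: fps_of_nat)
  \<comment> \<open>The range is enlarged, then cut to \<open>j \<le> m\<close>: the binomial
    vanishes beyond \<open>N\<close>, and the factor \<open>fps_X ^ j\<close> kills the coefficient
    beyond \<open>m\<close>.\<close>
  also have "\<dots> = (\<Sum>j\<le>max N m. of_nat (N choose j) * (fps_X ^ j * exp_mult_quot_power (k + j)) $ m)"
    by (rule sum.mono_neutral_left) auto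
  also have "\<dots> = (\<Sum>j\<le>m. of_nat (N choose j) * (fps_X ^ j * exp_mult_quot_power (k + j)) $ m)"
    by (rule sum.mono_neutral_right) (auto simp: fps_X_power_mult_nth)
  also have "\<dots> = (\<Sum>j\<le>m. of_nat (N choose j) * exp_mult_quot_power (k + j) $ (m - j))"
    by (rule sum.cong) (auto simp: fps_X_power_mult_nth)
  finally show "poly (ho_bernpoly m (- int k)) (1 + of_nat N)
      = poly (\<Sum>j\<le>m. smult (fact m / fact j * exp_mult_quot_power (k + j) $ (m - j)) (falling_poly j))
          (1 + of_nat N)"
    by (simp add: poly_ho_bernpoly poly_sum poly_falling_poly sum_distrib_left binomial_gbinomial mult_ac)
qed

section \<open>The triangular transform from \<open>b\<close> to \<open>c\<close>\<close>

lemma val2_of_nat_odd: "odd a \<Longrightarrow> val2 (of_nat a) = 0"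
  using val2_odd[of "int a"] by simp

lemma val2_ge_of_nat_even: "even a \<Longrightarrow> val2_ge 1 (of_nat a)"
  unfolding val2_ge_iff by (intro exI[of _ "int (a div 2)"] exI[of _ 1]) (auto elim!: evenE)

lemma val2_ge_two_mult: "val2_ge r x \<Longrightarrow> val2_ge (r + 1) (2 * x)"
  by (cases "x = 0") (auto simp: val2_ge_def val2_mult)

context
  fixes b :: "nat \<Rightarrow> rat" and m :: nat and r :: int
begin

definition tail_transform :: "nat \<Rightarrow> rat" where
  "tail_transform w = (\<Sum>j\<le>w. b j * (log_tail ^ j) $ (w - j))"

lemma val2_ge_tail_term:
  assumes "val2_ge (r - int (sigma2 (m - j))) (b j)" "j \<le> w" "w \<le> m"
    and "val2_ge (int (sigma2 (w - j)) + s) x"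
  shows "val2_ge (r + s - int (sigma2 (m - w))) (b j * x)"
  using val2_ge_mult[OF assms(1,4)] sigma2_add_le[of "w - j" "m - w"] assms(2,3)
  by (elim val2_ge_mono) simp

text \<open>The transform is unitriangular, since every power of \<open>P\<close> has constant term
  1, and its entries respect the weights by subadditivity of \<sigma>. Strong induction on
  \<open>w\<close> inverts it.\<close>

lemma val2_ge_tail_transform_iff:
  "(\<forall>w\<le>m. val2_ge (r - int (sigma2 (m - w))) (tail_transform w))
    \<longleftrightarrow> (\<forall>w\<le>m. val2_ge (r - int (sigma2 (m - w))) (b w))" (is "?lhs \<longleftrightarrow> ?rhs")
proof
  have summand: "val2_ge (r - int (sigma2 (m - w))) (b j * (log_tail ^ j) $ (w - j))"
    if "val2_ge (r - int (sigma2 (m - j))) (b j)" "j \<le> w" "w \<le> m" for j w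
    using val2_ge_tail_term[OF that, of 0] val2_ge_log_tail_power_weak by simp
  show ?lhs if ?rhs
    using that summand by (auto simp: tail_transform_def intro!: val2_ge_sum)
  show ?rhs if lhs: ?lhs
  proof (intro allI)
    fix w
    show "w \<le> m \<longrightarrow> val2_ge (r - int (sigma2 (m - w))) (b w)"
    proof (induction w rule: less_induct)
      case (less w)
      have "tail_transform w = b w + (\<Sum>j<w. b j * (log_tail ^ j) $ (w - j))"
        by (simp add: tail_transform_def flip: lessThan_Suc_atMost)
      then have "b w = tail_transform w - (\<Sum>j<w. b j * (log_tail ^ j) $ (w - j))" by simp
      moreover have "val2_ge (r - int (sigma2 (m - w))) (\<Sum>j<w. b j * (log_tail ^ j) $ (w - j))" if "w \<le> m"
        using less that by (intro val2_ge_sum summand) auto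
      ultimately show ?case using lhs by (simp add: val2_ge_diff)
    qed
  qed
qed

lemma tail_transform_cong:
  assumes "\<forall>w\<le>m. val2_ge (r - int (sigma2 (m - w))) (b w)" and "w \<le> m"
  shows "val2_ge (r + 1 - int (sigma2 (m - w)))
    (tail_transform w - (b w + (if w \<ge> 2 then 2 * of_nat (w - 2) * b (w - 2) else 0)))"
proof -
  \<comment> \<open>\<open>d\<close> keeps the only entries that matter to leading order: 1 on the
    diagonal and \<open>2 * j\<close> two places below it.\<close>
  define d :: "nat \<Rightarrow> rat" where "d j = (if j = w then 1 else if j + 2 = w then 2 * of_nat j else 0)" for j
  have "(\<Sum>j\<le>w. b j * d j) = (\<Sum>j\<le>w. (if j = w then b j else 0) + (if j + 2 = w then 2 * of_nat j * b j else 0))"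
    by (rule sum.cong) (auto simp: d_def)
  also have "\<dots> = b w + (\<Sum>j\<le>w. if j + 2 = w then 2 * of_nat j * b j else 0)"
    by (simp add: sum.distrib)
  also have "(\<Sum>j\<le>w. if j + 2 = w then 2 * of_nat j * b j else 0)
      = (if w \<ge> 2 then 2 * of_nat (w - 2) * b (w - 2) else 0)"
  proof (cases "w \<ge> 2")
    case True
    then have "(\<Sum>j\<le>w. if j + 2 = w then 2 * of_nat j * b j else 0)
        = (\<Sum>j\<le>w. if j = w - 2 then 2 * of_nat j * b j else 0)"
      by (intro sum.cong) auto
    then show ?thesis using True by simp
  qed (auto intro!: sum.neutral)
  finally have eq: "tail_transform w - (b w + (if w \<ge> 2 then 2 * of_nat (w - 2) * b (w - 2) else 0))
      = (\<Sum>j\<le>w. b j * ((log_tail ^ j) $ (w - j) - d j))"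
    by (simp add: tail_transform_def right_diff_distrib sum_subtractf)
  have "val2_ge (int (sigma2 (w - j)) + 1) ((log_tail ^ j) $ (w - j) - d j)" if "j \<le> w" for j
  proof -
    have "j = w \<or> w = j + 2 \<or> w - j \<noteq> 0 \<and> w - j \<noteq> 2" using that by arith
    then consider "j = w" | "w = j + 2" | "w - j \<noteq> 0" "w - j \<noteq> 2" by blast
    then show ?thesis
    proof cases
      case 1
      then show ?thesis by (simp add: d_def)
    next
      case 2
      then show ?thesis using val2_ge_log_tail_power_nth_2[of j] by (simp add: d_def sigma2_small)
    next
      case 3
      then have "d j = 0" by (auto simp: d_def)
      then show ?thesis using val2_ge_log_tail_power[OF 3] by simp
    qed
  qed
  then show ?thesis unfolding eq
    using assms by (intro val2_ge_sum val2_ge_tail_term) auto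
qed

end

section \<open>The maximum pole in terms of binomial coefficients\<close>

text \<open>These are the numbers \<open>a\<^sub>j\<close> of the introduction, with
  \<open>n = k + m\<close>.\<close>

definition newton_coeff :: "nat \<Rightarrow> nat \<Rightarrow> nat \<Rightarrow> rat" where
  "newton_coeff k m j = fact m / fact j * exp_mult_quot_power (k + j) $ (m - j)"

definition up_binomial :: "nat \<Rightarrow> nat \<Rightarrow> rat" where
  "up_binomial n j = of_nat ((n + j) choose n)"

lemma up_binomial_rec: "up_binomial n j * of_nat (n + j + 1) = up_binomial n (j + 1) * of_nat (j + 1)"
proof -
  have "((n + j) choose n) * (n + j + 1) = ((n + (j + 1)) choose n) * (j + 1)"
    using binomial_absorb_comp[of "n + (j + 1)" n] by (simp add: mult.commute)
  then show ?thesis unfolding up_binomial_def by (metis of_nat_mult)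
qed

lemma newton_coeff_eq:
  assumes "w \<le> m"
  shows "newton_coeff k m (m - w)
    = tail_transform (up_binomial (k + m)) w * (fact m / (fact (m - w) * 2 ^ w))"
proof -
  have "tail_transform (up_binomial (k + m)) w = 2 ^ w * exp_mult_quot_power (k + (m - w)) $ w"
    using inverse_log_quot_power_nth_eq[of w "k + m"] inverse_log_quot_power_nth[of "k + m" w] assms
    by (simp add: tail_transform_def up_binomial_def)
  then show ?thesis using assms by (simp add: newton_coeff_def)
qed

text \<open>By Legendre's formula the powers of 2 in \<open>m! / ((m - w)! 2^w)\<close> cancel
  except for a difference of digit sums.\<close>

lemma val2_ge_newton_coeff_iff:
  assumes "w \<le> m"
  shows "val2_ge r (newton_coeff k m (m - w))
    \<longleftrightarrow> val2_ge (r + int (sigma2 m) - int (sigma2 (m - w))) (tail_transform (up_binomial (k + m)) w)"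
proof -
  have "val2 (fact m / (fact (m - w) * 2 ^ w)) = int (sigma2 (m - w)) - int (sigma2 m)"
    using assms by (simp add: val2_divide val2_mult val2_fact val2_power)
  then have v: "r - val2 (fact m / (fact (m - w) * 2 ^ w)) = r + int (sigma2 m) - int (sigma2 (m - w))"
    by simp
  show ?thesis
    unfolding newton_coeff_eq[OF assms] by (subst val2_ge_mult_iff) (simp, simp only: v)
qed

text \<open>Thus \<sigma>(m) - M is the minimum of \<nu>(b_w) + \<sigma>(m - w) over
  \<open>w \<le> m\<close>.\<close>

lemma coeffs_ge_ho_bernpoly_iff:
  "coeffs_ge r (ho_bernpoly m (- int k))
    \<longleftrightarrow> (\<forall>w\<le>m. val2_ge (r + int (sigma2 m) - int (sigma2 (m - w))) (up_binomial (k + m) w))"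
proof -
  have "coeffs_ge r (ho_bernpoly m (- int k)) \<longleftrightarrow> (\<forall>j\<le>m. val2_ge r (newton_coeff k m j))"
    unfolding ho_bernpoly_eq_falling_sum newton_coeff_def[symmetric] by (rule coeffs_ge_falling_sum_iff)
  also have "\<dots> \<longleftrightarrow> (\<forall>w\<le>m. val2_ge r (newton_coeff k m (m - w)))"
    by (metis diff_diff_cancel diff_le_self)
  also have "\<dots> \<longleftrightarrow> (\<forall>w\<le>m. val2_ge (r + int (sigma2 m) - int (sigma2 (m - w)))
      (tail_transform (up_binomial (k + m)) w))"
    using val2_ge_newton_coeff_iff by blast
  also have "\<dots> \<longleftrightarrow> (\<forall>w\<le>m. val2_ge (r + int (sigma2 m) - int (sigma2 (m - w))) (up_binomial (k + m) w))"
    by (rule val2_ge_tail_transform_iff)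
  finally show ?thesis .
qed

lemma ho_bernpoly_nonzero: "ho_bernpoly m (- int k) \<noteq> 0"
proof
  assume "ho_bernpoly m (- int k) = 0"
  then have "\<forall>r. coeffs_ge r (ho_bernpoly m (- int k))" by (simp add: coeffs_ge_def)
  then have "\<forall>r. val2_ge (r + int (sigma2 m) - int (sigma2 (m - 0))) (up_binomial (k + m) 0)"
    using coeffs_ge_ho_bernpoly_iff by blast
  then show False by (auto simp: up_binomial_def val2_ge_def dest: spec[of _ 1])
qed

lemma poly_ho_bernpoly_1: "poly (ho_bernpoly m (- int k)) 1 = newton_coeff k m 0"
  by (simp add: poly_ho_bernpoly newton_coeff_def exp_mult_quot_power_def mult_ac)

lemma poly_falling_poly_0: "poly (falling_poly j) 0 = (-1) ^ j * fact j"
  by (induction j) (simp_all add: falling_poly_def algebra_simps)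

text \<open>At 0 the basis element of index \<open>j\<close> is \<open>j!\<close> up to sign, hence
  even for \<open>j\<close> at least 2; only the index 1 needs the second hypothesis.\<close>

lemma val2_ge_poly_ho_bernpoly_0:
  assumes "coeffs_ge r (ho_bernpoly m (- int k))" "m \<ge> 1 \<Longrightarrow> val2_ge (r + 1) (newton_coeff k m 1)"
  shows "val2_ge (r + 1) (poly (ho_bernpoly m (- int k)) 0 - newton_coeff k m 0)"
proof -
  have ge: "val2_ge r (newton_coeff k m j)" if "j \<le> m" for j
    using assms(1) that unfolding ho_bernpoly_eq_falling_sum newton_coeff_def[symmetric]
      coeffs_ge_falling_sum_iff by blast
  have "poly (ho_bernpoly m (- int k)) 0 = (\<Sum>j\<le>m. newton_coeff k m j * ((-1) ^ j * fact j))"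
    unfolding ho_bernpoly_eq_falling_sum newton_coeff_def[symmetric]
    by (simp add: poly_sum poly_falling_poly_0)
  also have "\<dots> - newton_coeff k m 0 = (\<Sum>j\<in>{..m} - {0}. newton_coeff k m j * ((-1) ^ j * fact j))"
    by (subst sum.remove[of _ 0]) auto
  finally have eq: "poly (ho_bernpoly m (- int k)) 0 - newton_coeff k m 0
      = (\<Sum>j\<in>{..m} - {0}. newton_coeff k m j * ((-1) ^ j * fact j))" .
  show ?thesis unfolding eq
  proof (rule val2_ge_sum)
    fix j assume j: "j \<in> {..m} - {0}"
    show "val2_ge (r + 1) (newton_coeff k m j * ((-1) ^ j * fact j))"
    proof (cases "j = 1")
      case True
      then show ?thesis using assms(2) j by simp
    next
      case False
      then have "even (fact j :: nat)" using j by (simp add: dvd_fact)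
      then have "val2_ge 1 (of_nat (fact j))" by (rule val2_ge_of_nat_even)
      then have "val2_ge 1 ((-1) ^ j * fact j)" by (cases "even j") simp_all
      then show ?thesis using ge[of j] j by (intro val2_ge_mult) auto
    qed
  qed
qed

section \<open>The coefficient of index 1 when \<nu>(k) \<le> \<nu>(n)\<close>

context
  fixes n k m :: nat and s :: int
  assumes k: "k \<ge> 1" and n: "n = k + m"
    and nk: "nu2 (of_nat k) \<le> nu2 (of_nat n)"
    and b_ge: "\<And>w. w \<le> m \<Longrightarrow> val2_ge (s - int (sigma2 (m - w))) (up_binomial n w)"
begin

text \<open>Here \<open>n + m = 2 n - k\<close> has valuation at most that of \<open>k\<close>,
  because \<open>2 n\<close> is divisible by a higher power of 2; and \<open>m = n - k\<close> is at
  least as divisible as \<open>k\<close>.\<close>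

lemma val2_add_le:
  assumes "m \<ge> 1"
  shows "val2 (of_nat (n + m)) \<le> val2 (of_nat m)"
proof -
  define e where "e = val2 (of_nat k)"
  have kn: "val2_ge e (of_nat n)" and kk: "val2_ge e (of_nat k)" "\<not> val2_ge (e + 1) (of_nat k)"
    using nk k n nu2_le_iff[of "of_nat n" "of_nat k"] by (auto simp: e_def val2_ge_def)
  have "val2_ge e (of_nat n - of_nat k)" using kn kk by (intro val2_ge_diff)
  then have "val2_ge e (of_nat m)" using n by simp
  moreover have "\<not> val2_ge (e + 1) (of_nat (n + m))"
  proof
    assume "val2_ge (e + 1) (of_nat (n + m))"
    then have "val2_ge (e + 1) (2 * of_nat n - of_nat (n + m))"
      using kn by (intro val2_ge_diff val2_ge_two_mult)
    then show False using kk n by simp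
  qed
  ultimately show ?thesis using assms by (auto simp: val2_ge_def)
qed

text \<open>The ratio of consecutive binomials is \<open>m / (n + m)\<close>, of nonnegative
  valuation, which gains 1 over the bound \<open>b_ge\<close>.\<close>

lemma val2_ge_up_binomial_pred:
  assumes "m \<ge> 1"
  shows "val2_ge s (up_binomial n (m - 1))"
proof -
  have eq: "up_binomial n (m - 1) * of_nat (n + m) = up_binomial n m * of_nat m"
    using up_binomial_rec[of n "m - 1"] assms by simp
  have "val2_ge (s + val2 (of_nat m)) (up_binomial n m * of_nat m)"
    using b_ge[of m] by (intro val2_ge_mult) (auto simp: val2_ge_def)
  then have "val2_ge (s + val2 (of_nat m) - val2 (of_nat (n + m))) (up_binomial n (m - 1))"
    unfolding eq[symmetric] using assms by (subst (asm) val2_ge_mult_iff) auto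
  then show ?thesis using val2_add_le[OF assms] by (elim val2_ge_mono) simp
qed

text \<open>Since \<sigma>(3) = 2, \<open>b_ge\<close> alone falls short by 1 after the factor 2.
  For odd \<open>m\<close> the factor \<open>m - 3\<close> is even; for even \<open>m\<close> a
  neighbouring binomial, at index \<open>m - 4\<close> or \<open>m - 2\<close> by the parity of
  \<open>n\<close>, gives the gain.\<close>

lemma val2_ge_up_binomial_pred3:
  assumes "m \<ge> 3"
  shows "val2_ge s (2 * of_nat (m - 3) * up_binomial n (m - 3))"
proof (cases "odd m")
  case True
  then have "val2_ge 1 (of_nat (m - 3))" using assms by (intro val2_ge_of_nat_even) auto
  then have "val2_ge ((s - 2) + (1 + 1)) (up_binomial n (m - 3) * (2 * of_nat (m - 3)))"
    using b_ge[of "m - 3"] assms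
    by (intro val2_ge_mult val2_ge_two_mult) (auto simp: sigma2_small)
  then show ?thesis by (simp add: mult_ac)
next
  case False
  have "val2_ge (s - 1) (up_binomial n (m - 3))"
  proof (cases "even n")
    case True
    have m4: "m \<ge> 4" using False assms by presburger
    have eq: "up_binomial n (m - 4) * of_nat (n + m - 3) = up_binomial n (m - 3) * of_nat (m - 3)"
      using up_binomial_rec[of n "m - 4"] m4 by (simp add: Suc_diff_Suc numeral_eq_Suc)
    have v: "val2 (of_nat (n + m - 3)) = 0" "val2 (of_nat (m - 3)) = 0"
      by (rule val2_of_nat_odd, use True False m4 in simp)+
    have "val2_ge (s - 1) (up_binomial n (m - 4))"
      using b_ge[of "m - 4"] m4 by (simp add: sigma2_small)
    then have "val2_ge (s - 1) (up_binomial n (m - 4) * of_nat (n + m - 3))"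
      using v m4 by (subst val2_ge_mult_iff) auto
    then show ?thesis
      unfolding eq using v m4 by (subst (asm) val2_ge_mult_iff) auto
  next
    case nodd: False
    have eq: "up_binomial n (m - 3) * of_nat (n + m - 2) = up_binomial n (m - 2) * of_nat (m - 2)"
      using up_binomial_rec[of n "m - 3"] assms by (simp add: Suc_diff_Suc numeral_eq_Suc)
    have v: "val2 (of_nat (n + m - 2)) = 0"
      by (rule val2_of_nat_odd) (use nodd False assms in simp)
    have "val2_ge ((s - 1) + 0) (up_binomial n (m - 2) * of_nat (m - 2))"
      using b_ge[of "m - 2"] assms by (intro val2_ge_mult val2_ge_of_nat) (simp add: sigma2_small)
    then show ?thesis
      unfolding eq[symmetric] using v assms by (subst (asm) val2_ge_mult_iff) auto
  qed
  then have "val2_ge ((s - 1) + (0 + 1)) (up_binomial n (m - 3) * (2 * of_nat (m - 3)))"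
    by (intro val2_ge_mult val2_ge_two_mult) auto
  then show ?thesis by (simp add: mult_ac)
qed

text \<open>This is the case \<open>w = m - 1\<close>, where \<sigma>(m - w) = 1, so the congruence
  for the transform holds exactly to precision \<open>s\<close>.\<close>

lemma val2_ge_newton_coeff_1:
  assumes "m \<ge> 1"
  shows "val2_ge (s - int (sigma2 m) + 1) (newton_coeff k m 1)"
proof -
  let ?d = "if m - 1 \<ge> 2 then 2 * of_nat (m - 1 - 2) * up_binomial n (m - 1 - 2) else 0"
  have "val2_ge s (tail_transform (up_binomial n) (m - 1) - (up_binomial n (m - 1) + ?d))"
    using tail_transform_cong[of m s "up_binomial n" "m - 1"] b_ge assms by simp
  moreover have "val2_ge s ?d"
    using val2_ge_up_binomial_pred3 by (auto simp: numeral_eq_Suc)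
  then have "val2_ge s (up_binomial n (m - 1) + ?d)"
    using val2_ge_up_binomial_pred[OF assms] by (intro val2_ge_add)
  ultimately have "val2_ge s (tail_transform (up_binomial n) (m - 1))"
    using val2_ge_add by fastforce
  then show ?thesis
    using val2_ge_newton_coeff_iff[of "m - 1" m "s - int (sigma2 m) + 1" k] assms n by simp
qed

end

section \<open>Comparison with the partition terms\<close>

lemma val2_of_nat_choose:
  "val2 (of_nat ((k + m) choose k)) = int (sigma2 k) + int (sigma2 m) - int (sigma2 (k + m))"
proof -
  have "val2 (of_nat ((k + m) choose k)) = val2 (fact (k + m) / (fact k * fact m))"
    using binomial_fact[of k "k + m", where 'a = rat] by simp
  then show ?thesis by (simp add: val2_divide val2_mult val2_fact)
qed

lemma minus_gchoose: "(- of_nat n - 1) gchoose j = (-1) ^ j * (up_binomial n j :: rat)"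
proof -
  have "(- (of_nat n + 1) :: rat) gchoose j = (-1) ^ j * ((of_nat n + 1 + of_nat j - 1) gchoose j)"
    by (rule gbinomial_minus)
  also have "(of_nat n + 1 + of_nat j - 1 :: rat) = of_nat (n + j)" by simp
  also have "of_nat (n + j) gchoose j = up_binomial n j"
    using binomial_symmetric[of n "n + j"] by (simp add: up_binomial_def binomial_gbinomial)
  finally show ?thesis by simp
qed

lemma part_tau_ones:
  assumes "n = k + m"
  shows "part_tau n k ((\<lambda>i. 0)(1 := m)) = (-1) ^ m * (up_binomial n m * (fact m / 2 ^ m))"
proof -
  have supp: "part_supp ((\<lambda>i. 0)(1 := m)) = (if m = 0 then {} else {1})"
    by (auto simp: part_supp_def)
  have "n - k = m" using assms by simp
  then show ?thesis
    unfolding part_tau_def part_t_def part_weight_def part_size_def supp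
    by (cases "m = 0") (simp_all add: minus_gchoose up_binomial_def)
qed

text \<open>The partition has size \<open>m - 2\<close> and multinomial coefficient
  \<open>m - 2\<close>; its denominator \<open>2^(m-3) * 4 = 2^(m-1)\<close> leaves the factor
  2.\<close>

lemma part_tau_ones_three:
  assumes "n = k + m" "m \<ge> 3"
  shows "part_tau n k ((\<lambda>i. 0)(1 := m - 3, 3 := 1))
    = (-1) ^ m * (2 * of_nat (m - 2) * up_binomial n (m - 2) * (fact m / 2 ^ m))"
proof -
  obtain j where m: "m = j + 3" using assms(2) by (metis add.commute le_Suc_ex)
  have supp: "part_supp ((\<lambda>i. 0)(1 := m - 3, 3 := 1)) = (if m = 3 then {3} else {1, 3})"
    using assms(2) by (auto simp: part_supp_def split: if_splits)
  have nk: "n - k = j + 3" using assms m by simp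
  show ?thesis
  proof (cases "j = 0")
    case True
    then show ?thesis using minus_gchoose[of n 1]
      unfolding part_tau_def part_t_def part_weight_def part_size_def supp nk
      by (simp add: m)
  next
    case False
    then show ?thesis
      unfolding part_tau_def part_t_def part_weight_def part_size_def supp nk
      by (simp add: m minus_gchoose power_add divide_simps)
  qed
qed

theorem theorem3p8:
  fixes n k :: nat and M :: int and u u' :: "nat \<Rightarrow> nat"
  assumes "k \<ge> 1" and "n \<ge> k"
    and "nu2 (of_nat k) \<le> nu2 (of_nat n)"
    and "M = max_pole (ho_bernpoly (n - k) (- int k))"
    and "u = (\<lambda>i. 0)(1 := n - k)"
    and "u' = (\<lambda>i. 0)(1 := n - k - 3, 3 := 1)"
  shows
    "(AMZC n k \<longleftrightarrow> SAMZC (n + 1) (k + 1)) \<and>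
     (AMZC n k \<longleftrightarrow>
        (nu2 (of_nat ((n + (n - k)) choose n)) = ereal (of_nat (sigma2 (n - k)) - of_int M)) \<noteq>
        (odd (n - k) \<and>
         nu2 (of_nat ((n + (n - k) - 2) choose n)) = ereal (of_nat (sigma2 (n - k)) - of_int (M + 1)))) \<and>
     (AMZC n k \<longleftrightarrow>
        (nu2 (part_tau n k u) = ereal (of_int (- M))) \<noteq>
        (n - k \<ge> 3 \<and> odd (n - k) \<and> nu2 (part_tau n k u') = ereal (of_int (- M)))) \<and>
     (AMZC n k \<longrightarrow>
        nu2 (of_nat (Stirling n k)) = nu2 (of_nat (Stirling (n + 1) (k + 1))) \<and>
        (nu2 (part_tau n k u) = ereal (of_int (- M)) \<longrightarrow>
           nu2 (of_nat (Stirling n k)) =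
             ereal (of_nat (sigma2 k) - of_nat (sigma2 n)) + nu2 (of_nat ((n + (n - k)) choose n))) \<and>
        (n - k \<ge> 3 \<and> odd (n - k) \<and> nu2 (part_tau n k u') = ereal (of_int (- M)) \<longrightarrow>
           nu2 (of_nat (Stirling n k)) =
             ereal (of_nat (sigma2 k) - of_nat (sigma2 n)) +
             nu2 (of_nat ((n + (n - k) - 2) choose n)) + 1))"
proof -
  define m where "m = n - k"
  have n: "n = k + m" and m: "n - k = m" using assms(2) by (simp_all add: m_def)
  define f where "f = ho_bernpoly m (- int k)"
  \<comment> \<open>The weighted minimum of the valuations of the \<open>b w\<close>, against which
    both summands of the congruence are tested.\<close>
  define s where "s = int (sigma2 m) - M"
  define b where "b = up_binomial n"
  define y where "y = (if m \<ge> 2 then 2 * of_nat (m - 2) * b (m - 2) else 0)"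
  have M: "M = max_pole f" using assms(4) by (simp add: f_def m)
  have f_ge: "coeffs_ge (- M) f"
    using coeffs_ge_iff_max_pole[of f] ho_bernpoly_nonzero by (auto simp: f_def M)
  have b_ge: "val2_ge (s - int (sigma2 (m - w))) (b w)" if "w \<le> m" for w
    using f_ge that unfolding f_def coeffs_ge_ho_bernpoly_iff b_def n s_def by simp
  have a0_ge: "val2_ge (- M) (newton_coeff k m 0)"
    using f_ge unfolding f_def ho_bernpoly_eq_falling_sum newton_coeff_def[symmetric]
      coeffs_ge_falling_sum_iff by blast
  have a1_ge: "val2_ge (- M + 1) (newton_coeff k m 1)" if "m \<ge> 1"
    using val2_ge_newton_coeff_1[of k n m s] assms(1,3) n b_ge that by (simp add: s_def b_def)
  have bm: "val2_ge s (b m)" using b_ge[of m] by simp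
  have bm2: "val2_ge (s - 1) (b (m - 2))" if "m \<ge> 2"
    using b_ge[of "m - 2"] that by (simp add: sigma2_small)
  have y_ge: "val2_ge s y"
    using val2_ge_mult[OF val2_ge_two_mult[OF val2_ge_of_nat] bm2, of "m - 2"] by (simp add: y_def)
  \<comment> \<open>For even \<open>m\<close> the factor \<open>m - 2\<close> supplies a further 2,
    so \<open>y\<close> never attains the minimum; hence the oddness condition in the
    alternatives.\<close>
  have y_even: "val2_ge (s + 1) y" if "even m"
    using val2_ge_mult[OF val2_ge_two_mult[OF val2_ge_of_nat_even] bm2, of "m - 2"] that
    by (simp add: y_def add.commute del: of_nat_diff)

  have f1: "nu2 (poly f 1) = ereal (of_int (- M)) \<longleftrightarrow> val2_ge (s + 1) (b m) \<noteq> val2_ge (s + 1) y"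
  proof -
    have "nu2 (poly f 1) = ereal (of_int (- M)) \<longleftrightarrow> \<not> val2_ge (- M + 1) (newton_coeff k m 0)"
      unfolding nu2_eq_iff f_def poly_ho_bernpoly_1 using a0_ge by simp
    also have "\<dots> \<longleftrightarrow> \<not> val2_ge (s + 1) (tail_transform b m)"
      using val2_ge_newton_coeff_iff[of m m "- M + 1" k] by (simp add: s_def b_def n algebra_simps)
    also have "\<dots> \<longleftrightarrow> \<not> val2_ge (s + 1) (b m + y)"
    proof -
      have "val2_ge (s + 1) (tail_transform b m - (b m + y))"
        using tail_transform_cong[of m s b m] b_ge by (simp add: y_def)
      then show ?thesis
        using val2_ge_add_cancel[of "s + 1" "tail_transform b m - (b m + y)" "b m + y"] by simp
    qed
    also have "\<dots> \<longleftrightarrow> val2_ge (s + 1) (b m) \<noteq> val2_ge (s + 1) y"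
      using val2_ge_Suc_add_iff[OF bm y_ge] by blast
    finally show ?thesis .
  qed
  have f0: "nu2 (poly f 0) = ereal (of_int (- M)) \<longleftrightarrow> nu2 (poly f 1) = ereal (of_int (- M))"
  proof -
    have d: "val2_ge (- M + 1) (poly f 0 - poly f 1)"
      using val2_ge_poly_ho_bernpoly_0[of "- M" m k] f_ge a1_ge
      unfolding f_def poly_ho_bernpoly_1 by blast
    then have "val2_ge (- M) (poly f 0 - poly f 1)" by (rule val2_ge_mono) simp
    with d show ?thesis
      unfolding nu2_eq_iff
      using val2_ge_add_cancel[of _ "poly f 0 - poly f 1" "poly f 1"] by simp
  qed

  define c where "c = (of_nat (n choose k) :: rat)"
  have c: "c \<noteq> 0" "val2 c = int (sigma2 k) + int (sigma2 m) - int (sigma2 n)"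
    using val2_of_nat_choose[of k m] by (simp_all add: c_def n)
  have S0: "of_nat (Stirling n k) = c * poly f 0"
    by (simp add: f_def poly_ho_bernpoly of_nat_Stirling c_def n)
  have S1: "of_nat (Stirling (n + 1) (k + 1)) = c * poly f 1"
    using of_nat_Stirling_Suc[of k m]
    by (simp add: f_def poly_ho_bernpoly exp_mult_quot_power_def c_def n mult_ac del: Stirling.simps)
  \<comment> \<open>\<open>c\<close> is nonzero, so its finite valuation can be subtracted on both
    sides.\<close>
  have cancel: "nu2 (c * x) = nu2 c - ereal (of_int M) \<longleftrightarrow> nu2 x = ereal (of_int (- M))" for x
    using c(1) by (cases "x = 0") (auto simp: nu2_def val2_mult)
  have amzc: "AMZC n k \<longleftrightarrow> nu2 (poly f 0) = ereal (of_int (- M))"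
    unfolding AMZC_def S0 c_def[symmetric] m f_def[symmetric] M[symmetric] by (rule cancel)
  \<comment> \<open>Shifting both arguments by 1 gives the same binomial and the same polynomial as
    in \<open>AMZC n k\<close>, so only the evaluation point differs.\<close>
  have "SAMZC (n + 1) (k + 1) \<longleftrightarrow> nu2 (of_nat (Stirling (n + 1) (k + 1))) = nu2 c - ereal (of_int M)"
    by (simp add: SAMZC_def M f_def m c_def del: Stirling.simps)
  then have samzc: "SAMZC (n + 1) (k + 1) \<longleftrightarrow> nu2 (poly f 1) = ereal (of_int (- M))"
    unfolding S1 cancel .

  have b_iff: "nu2 (of_nat ((n + m) choose n)) = ereal (of_nat (sigma2 m) - of_int M)
      \<longleftrightarrow> \<not> val2_ge (s + 1) (b m)"
    using nu2_eq_iff[of "b m" s] bm by (simp add: b_def up_binomial_def s_def)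
  have y_iff: "odd m \<and> nu2 (of_nat ((n + m - 2) choose n)) = ereal (of_nat (sigma2 m) - of_int (M + 1))
      \<longleftrightarrow> \<not> val2_ge (s + 1) y"
  proof (cases "odd m \<and> m \<ge> 3")
    case True
    then have "n + m - 2 = n + (m - 2)" by simp
    then have "nu2 (of_nat ((n + m - 2) choose n)) = ereal (of_nat (sigma2 m) - of_int (M + 1))
        \<longleftrightarrow> nu2 (b (m - 2)) = ereal (of_int (s - 1))"
      by (simp add: b_def up_binomial_def s_def algebra_simps)
    also have "\<dots> \<longleftrightarrow> \<not> val2_ge s (b (m - 2))"
      unfolding nu2_eq_iff using bm2 True by simp
    also have "val2_ge s (b (m - 2)) \<longleftrightarrow> val2_ge (s + 1) y"
    proof -
      have v: "val2 (of_nat (m - 2)) = 0" by (rule val2_of_nat_odd) (use True in simp)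
      have "val2 (2 * of_nat (m - 2)) = val2 2 + val2 (of_nat (m - 2))"
        by (rule val2_mult) (use True in auto)
      then have "val2 (2 * of_nat (m - 2)) = 1" using v by simp
      moreover have "y = b (m - 2) * (2 * of_nat (m - 2))" using True by (simp add: y_def mult_ac)
      ultimately show ?thesis using True val2_ge_mult_iff[of "2 * of_nat (m - 2)" "s + 1" "b (m - 2)"] by simp
    qed
    finally show ?thesis using True by blast
  next
    case False
    then have "even m \<or> m = 1" by presburger
    then consider "even m" | "m = 1" by blast
    then show ?thesis
    proof cases
      case 1
      then show ?thesis using y_even by simp
    next
      case 2
      \<comment> \<open>For \<open>m = 1\<close> the upper index is \<open>n - 1\<close>, so the
        binomial vanishes and its valuation is infinite, in agreement with
        \<open>y = 0\<close>.\<close>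
      have "(n + m - 2) choose n = 0" using 2 assms(1,2) by (intro binomial_eq_0) simp
      then show ?thesis using 2 by (simp add: y_def nu2_def)
    qed
  qed

  \<comment> \<open>Both partition terms are a summand times \<open>m! / 2^m\<close>, whose
    valuation is -\<sigma>(m); this moves the threshold from \<open>s\<close> to
    \<open>- M\<close>.\<close>
  have tau: "nu2 ((-1) ^ m * (x * (fact m / 2 ^ m))) = ereal (of_int (- M)) \<longleftrightarrow> \<not> val2_ge (s + 1) x"
    if "val2_ge s x" for x
  proof -
    have v: "val2 (fact m / 2 ^ m) = - int (sigma2 m)"
      by (simp add: val2_divide val2_fact val2_power)
    have "nu2 ((-1) ^ m * (x * (fact m / 2 ^ m))) = nu2 (x * (fact m / 2 ^ m))"
      by (cases "even m") (simp_all add: nu2_def)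
    also have "\<dots> = ereal (of_int (- M)) \<longleftrightarrow> nu2 x = ereal (of_int s)"
      using v val2_mult[of x "fact m / 2 ^ m"] by (auto simp: nu2_def s_def)
    also have "\<dots> \<longleftrightarrow> \<not> val2_ge (s + 1) x"
      unfolding nu2_eq_iff using that by simp
    finally show ?thesis .
  qed
  have u_iff: "nu2 (part_tau n k u) = ereal (of_int (- M)) \<longleftrightarrow> \<not> val2_ge (s + 1) (b m)"
    using tau[OF bm] part_tau_ones[OF n] by (simp add: assms(5) m b_def)
  have u'_iff: "m \<ge> 3 \<and> odd m \<and> nu2 (part_tau n k u') = ereal (of_int (- M)) \<longleftrightarrow> \<not> val2_ge (s + 1) y"
  proof (cases "m \<ge> 3")
    case True
    have "nu2 (part_tau n k u') = ereal (of_int (- M)) \<longleftrightarrow> \<not> val2_ge (s + 1) y"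
      using tau[OF y_ge] part_tau_ones_three[OF n True] True by (simp add: assms(6) m b_def y_def)
    then show ?thesis using True y_even by blast
  next
    case False
    then have "y = 0 \<or> even m" by (cases "m = 2") (auto simp: y_def)
    then show ?thesis using False y_even by auto
  qed

  have "nu2 (of_nat (Stirling n k)) = ereal (of_int (val2 c - M))"
    "nu2 (of_nat (Stirling (n + 1) (k + 1))) = ereal (of_int (val2 c - M))" if "AMZC n k"
    using that f0 c(1) unfolding amzc S0 S1 nu2_mult by (simp_all add: nu2_def)
  then have S: "nu2 (of_nat (Stirling n k)) = ereal (of_nat (sigma2 k) - of_nat (sigma2 n) + (of_nat (sigma2 m) - of_int M))"
    "nu2 (of_nat (Stirling n k)) = nu2 (of_nat (Stirling (n + 1) (k + 1)))" if "AMZC n k"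
    using that c(2) by (simp_all add: algebra_simps)

  show ?thesis unfolding m
  proof (intro conjI impI)
    show "AMZC n k \<longleftrightarrow> SAMZC (n + 1) (k + 1)"
      unfolding amzc samzc f0 ..
    show "AMZC n k \<longleftrightarrow>
        (nu2 (of_nat ((n + m) choose n)) = ereal (of_nat (sigma2 m) - of_int M)) \<noteq>
        (odd m \<and> nu2 (of_nat ((n + m - 2) choose n)) = ereal (of_nat (sigma2 m) - of_int (M + 1)))"
      unfolding amzc f0 f1 b_iff y_iff by blast
    show "AMZC n k \<longleftrightarrow>
        (nu2 (part_tau n k u) = ereal (of_int (- M))) \<noteq>
        (m \<ge> 3 \<and> odd m \<and> nu2 (part_tau n k u') = ereal (of_int (- M)))"
      unfolding amzc f0 f1 u_iff u'_iff by blast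
    assume *: "AMZC n k"
    show "nu2 (of_nat (Stirling n k)) = nu2 (of_nat (Stirling (n + 1) (k + 1)))"
      by (rule S(2)[OF *])
    show "nu2 (of_nat (Stirling n k))
        = ereal (of_nat (sigma2 k) - of_nat (sigma2 n)) + nu2 (of_nat ((n + m) choose n))"
      if "nu2 (part_tau n k u) = ereal (of_int (- M))"
      unfolding S(1)[OF *] b_iff[THEN iffD2, OF that[unfolded u_iff]] by simp
    show "nu2 (of_nat (Stirling n k))
        = ereal (of_nat (sigma2 k) - of_nat (sigma2 n)) + nu2 (of_nat ((n + m - 2) choose n)) + 1"
      if "m \<ge> 3 \<and> odd m \<and> nu2 (part_tau n k u') = ereal (of_int (- M))"
      \<comment> \<open>The binomial here has valuation \<sigma>(m) - (M + 1), which the final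
        \<open>+ 1\<close> compensates.\<close>
      unfolding S(1)[OF *] y_iff[THEN iffD2, OF that[unfolded u'_iff], THEN conjunct2]
      by (simp add: one_ereal_def)
  qed
qed

end
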